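(* Let $Q(x,v)=\tilde Q(e_Q(x,v),\ell^2(x,v))$ be a spherically symmetric steady state solution of the gravitational Vlasov-Poisson system with potential $U_Q=U_Q(r)$, $r=|x|$. Suppose that the functions \[ (R,P,B)(t)=(R(t,r,p_r,\beta),\,P(t,r,p_r,\beta),\,B(t,r,p_r,\beta)) \] are such that \[ f(t,r,p_r,\beta)=\tilde Q\Big(e_Q\big(R(t),P(t),B(t)\big),\,B(t)\Big) \] (with $R,P,B$ evaluated at $(t,r,p_r,\beta)$) is a solution to the gravitational Vlasov-Poisson system, and moreover $R$ and $P$ are independent of $\beta$, and $B=\beta$ is constant, i.e. \[ (R,P,B)(t)=(R(t,r,p_r),\,P(t,r,p_r),\,\beta). \] Let there exist a Hamiltonian $H=H(t,r,p_r)$ such that $\partial_t Z=J\nabla H(t,Z)$ is satisfied for $Z=(R,P)$, where $J=\begin{pmatrix}0&1\\-1&0\end{pmatrix}$ and $\nabla=(\partial_r,\partial_{p_r})$. In addition, assume that (a) $\partial_e\tilde Q\neq 0$ on the support of $Q$, and $U_Q'(0)=0$; (b) $\partial_r R>0$, and there is a function $\sigma(t)$ such that \[ \lim_{\delta\to 0}\frac{R(t,\delta,p_r)}{\delta}=\sigma(t); \] (c) for the Jacobian of the map $(r,p_r)\mapsto (R(0,r,p_r),P(0,r,p_r))$ we have \[ \det\Big(\frac{\partial (R(0,r,p_r),P(0,r,p_r))}{\partial (r,p_r)}\Big)=1. \] Then, defining $\alpha=U_Q''(0)$, there is a function $\phi=\phi(t)$ such that for all $(t,r,p_r)$ \[ U_Q'(r)=\alpha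 r,\qquad R(t,r,p_r)=R(t,r)=\frac{r}{\phi(t)},\qquad P(t,r,p_r)=\phi(t)\,p_r-\dot\phi(t)\,r, \] and $\phi$ solves \[ \ddot\phi(t)=\alpha\Big(-\frac{1}{\phi(t)^2}+\frac{1}{\phi(t)^3}\Big). \]
   Context: The gravitational Vlasov-Poisson system for $f=f(t,x,v)$, $(t,x,v)\in\mathbb R\times\mathbb R^3\times\mathbb R^3$, is \[ \partial_t f+v\cdot\nabla_x f-\nabla_x U_f\cdot\nabla_v f=0, \] \[ \Delta_x U_f(t,x)=4\pi\rho_f(t,x),\quad \lim_{|x|\to\infty}U_f(t,x)=0,\quad \rho_f(t,x)=\int_{\mathbb R^3}f(t,x,v)\,dv, \] so $U_f(t,x)=-\int_{\mathbb R^3}\frac{\rho_f(t,y)}{|y-x|}\,dy$. A steady state is a time-independent solution $Q=Q(x,v)$, with potential $U_Q$. A function $g(x,v)$ is spherically symmetric if $g(Ax,Av)=g(x,v)$ for all $A\in{\rm SO}(3)$ and $x,v\in\mathbb R^3$. In this case $g$ is written as a function of $r=|x|$, $p_r=\frac{x\cdot v}{|x|}$ and $\beta=\ell^2=|x\wedge v|^2=|x|^2|v|^2-(x\cdot v)^2$, and its potential is a function of $r$ (and of $t$, if time-dependent). In these variables the Vlasov equation reads \[ \partial_t f+p_r\,\partial_r f+\Big(\frac{\beta}{r^3}-\partial_r U_f(t,r)\Big)\partial_{p_r}f=0, \] and $\partial_r U_f(t,r)=\frac{4\pi}{r^2}\int_0^r s^2\rho_f(t,s)\,ds$. The particle energy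 is $e_Q(x,v)=\frac12|v|^2+U_Q(x)$, i.e. $e_Q(r,p_r,\beta)=\frac12 p_r^2+U_Q(r)+\frac{\beta}{2r^2}$, and $\tilde Q=\tilde Q(e,\beta)$ is a function of two variables, with $\partial_e\tilde Q$ its derivative in the first variable. Primes on $U_Q$ denote derivatives with respect to $r$, and dots denote derivatives with respect to $t$. All functions are understood to be regular enough for the derivatives involved to make sense; the paper does not specify precise regularity.
   Formalization: The formulas for R, P are asserted on the support of f, U_Q'=αr only on the support of Q and unless φ≡1 (literally false otherwise, e.g. Kurth's Q or R=r, P=p). Added: {Q≠0} is connected and Q(0,v)≠0 for some v; R, P are C² up to r=0. *)

theory Defs
  imports "HOL-Analysis.Analysis"
begin

definition C1_on :: "'a::real_normed_vector set \<Rightarrow> ('a \<Rightarrow> 'b::real_normed_vector) \<Rightarrow> bool" where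
  "C1_on S f \<longleftrightarrow> (\<exists>D :: 'a \<Rightarrow> 'a \<Rightarrow>\<^sub>L 'b.
     (\<forall>z\<in>S. (f has_derivative blinfun_apply (D z)) (at z within S)) \<and> continuous_on S D)"

definition C2_on :: "'a::real_normed_vector set \<Rightarrow> ('a \<Rightarrow> 'b::real_normed_vector) \<Rightarrow> bool" where
  "C2_on S f \<longleftrightarrow> (\<exists>D :: 'a \<Rightarrow> 'a \<Rightarrow>\<^sub>L 'b.
     (\<forall>z\<in>S. (f has_derivative blinfun_apply (D z)) (at z within S)) \<and> C1_on S D)"

type_synonym phase_fun = "real ^ 3 \<Rightarrow> real ^ 3 \<Rightarrow> real"

definition density :: "phase_fun \<Rightarrow> real ^ 3 \<Rightarrow> real" where
  "density g x = (LINT v|lborel. g x v)"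

text \<open>The solution of Poisson's equation \<open>\<Delta>U = 4\<pi>\<rho>\<close> that vanishes at infinity, as a Newtonian potential.\<close>

definition potential :: "phase_fun \<Rightarrow> real ^ 3 \<Rightarrow> real" where
  "potential g x = - (LINT y|lborel. density g y / norm (y - x))"

text \<open>
  The Vlasov equation is required at the points where \<open>f \<noteq> 0\<close>, which form an open set. In the interior of
  the complement it holds trivially. On the boundary of the support \<open>f\<close> need not even be
  continuous: this is the case for the Kurth solution, whose density in phase space is unbounded
  near that boundary.
\<close>

definition vlasov_poisson :: "(real \<Rightarrow> phase_fun) \<Rightarrow> bool" where
  "vlasov_poisson f \<longleftrightarrow>
     open {(t, x, v). f t x v \<noteq> 0} \<and>
     (\<forall>t x. integrable lborel (f t x)) \<and>
     (\<forall>t x. integrable lborel (\<lambda>y. density (f t) y / norm (y - x))) \<and>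
     (\<forall>t. (potential (f t) \<longlongrightarrow> 0) at_infinity) \<and>
     (\<forall>t x v. f t x v \<noteq> 0 \<longrightarrow>
        (\<lambda>(s, y, w). f s y w) differentiable (at (t, x, v)) \<and>
        (\<exists>ft fx fv Ux.
           ((\<lambda>s. f s x v) has_real_derivative ft) (at t) \<and>
           (GDERIV (\<lambda>y. f t y v) x :> fx) \<and>
           (GDERIV (\<lambda>w. f t x w) v :> fv) \<and>
           (GDERIV (potential (f t)) x :> Ux) \<and>
           ft + v \<bullet> fx - Ux \<bullet> fv = 0))"

definition ang_mom_sq :: phase_fun where
  "ang_mom_sq x v = (norm x)\<^sup>2 * (norm v)\<^sup>2 - (x \<bullet> v)\<^sup>2"

text \<open>
  The spherically symmetric \<open>g\<close> is given by \<open>h\<close> in the variables \<open>(r, p\<^sub>r, \<beta>)\<close>. These are singular at \<open>x = 0\<close>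
  (where \<open>p\<^sub>r\<close> is undefined), so the value of \<open>g\<close> there is not prescribed by \<open>h\<close>.
\<close>

definition radial_form :: "phase_fun \<Rightarrow> (real \<Rightarrow> real \<Rightarrow> real \<Rightarrow> real) \<Rightarrow> bool" where
  "radial_form g h \<longleftrightarrow>
     (\<forall>x v. x \<noteq> 0 \<longrightarrow> g x v = h (norm x) (x \<bullet> v / norm x) (ang_mom_sq x v))"

definition energy :: "(real \<Rightarrow> real) \<Rightarrow> phase_fun" where
  "energy U x v = (norm v)\<^sup>2 / 2 + U (norm x)"

definition radial_energy :: "(real \<Rightarrow> real) \<Rightarrow> real \<Rightarrow> real \<Rightarrow> real \<Rightarrow> real" where
  "radial_energy U r p \<beta> = p\<^sup>2 / 2 + U r + \<beta> / (2 * r\<^sup>2)"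

text \<open>The pairs \<open>(r, p\<^sub>r)\<close> over which the support of \<open>h\<close> lies.\<close>

definition radial_support :: "(real \<Rightarrow> real \<Rightarrow> real \<Rightarrow> real) \<Rightarrow> (real \<times> real) set" where
  "radial_support h = closure {(r, p). 0 < r \<and> (\<exists>\<beta>\<ge>0. h r p \<beta> \<noteq> 0)}"

end

theory Submission
  imports Defs
begin

text \<open>
  Why the motion must be homologous. Along the radial characteristics
  \<open>r' = p\<close>, \<open>p' = \<beta> / r\<^sup>3 - \<partial>\<^sub>r U\<^sub>f\<close>, with \<open>\<beta>\<close> fixed, the density \<open>f\<close> is constant (\<open>radial_vlasov\<close>). Since
  \<open>f = Qt(e(R, P, \<beta>), \<beta>)\<close> and \<open>\<partial>\<^sub>e Qt \<noteq> 0\<close> on the support, the energy \<open>e(R, P, \<beta>)\<close> is stationary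
  along them. But \<open>R\<close> and \<open>P\<close> do not depend on \<open>\<beta>\<close>, so the resulting equation is a quadratic
  polynomial in \<open>\<beta>\<close>; the support being open, it holds on an interval of \<open>\<beta>\<close> and its three
  coefficients vanish (\<open>transport_equations\<close>):
  \<open>\<partial>\<^sub>p R = 0\<close>, an equation \<open>P \<partial>\<^sub>p P R\<^sup>3 = r\<^sup>3 (\<partial>\<^sub>t R + p \<partial>\<^sub>r R)\<close>, and a force balance.

  A Hamiltonian flow preserves the Jacobian (\<open>hamiltonian_flow_jacobian_constant\<close>), which is \<open>1\<close>
  initially; so \<open>\<partial>\<^sub>r R \<partial>\<^sub>p P = 1\<close>. Differentiating the second equation in \<open>p\<close> then gives
  \<open>R\<^sup>3 = (r \<partial>\<^sub>r R)\<^sup>3\<close>: near each point of the support \<open>R = c(t) r\<close> and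
  \<open>P = p / c + r c' / c\<^sup>2\<close> (\<open>linear_of_transport_equations\<close>).

  To see that \<open>c\<close> is the same at every point of the support, follow the inverse of this linear map
  over the region of \<open>(r, p)\<close> that carries \<open>Q\<close>. The points where it inverts \<open>(R, P)\<close> form an open
  and closed subset, and the region is connected: it is obtained from the connected open support
  of \<open>Q\<close> by removing the set \<open>x = 0\<close> of codimension three (\<open>connected_Diff_axis\<close>). The region
  touches \<open>r = 0\<close>, where the slope of \<open>R\<close> is \<open>\<sigma>(t)\<close>, whence \<open>c = \<sigma>\<close> (\<open>linear_on_base_from_point\<close>,
  \<open>R_eq_sigma\<close>). The support of \<open>f\<close> is never empty, because at \<open>r = 0\<close> the Jacobian identity reads
  \<open>\<sigma> \<partial>\<^sub>p P = 1\<close> and \<open>P(t, 0, \<cdot>)\<close> takes every value, also those below which \<open>Q\<close> lives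
  (\<open>base_nonempty\<close>).

  So \<open>f\<close> is the affine rescaling \<open>f(t, x, v) = Q(\<sigma> x, v / \<sigma> + (\<sigma>' / \<sigma>\<^sup>2) x)\<close>, and a change of variables
  in the Newtonian potential yields \<open>U\<^sub>f(t, r) = \<sigma> U(\<sigma> r)\<close> (\<open>potential_F\<close>). With \<open>\<phi> = 1 / \<sigma>\<close> the force
  balance becomes \<open>\<phi>'' \<phi> s = (1 / \<phi>\<^sup>2 - 1 / \<phi>) U'(s)\<close> for every radius \<open>s\<close> of the support of \<open>Q\<close>. Dividing by
  \<open>s\<close> and letting \<open>s \<rightarrow> 0\<close> gives the differential equation of \<open>\<phi>\<close>, and comparing the two shows
  \<open>U'(s) = \<alpha> s\<close> as soon as \<open>\<phi>\<close> is not constantly \<open>1\<close>.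
\<close>

section \<open>Twice continuously differentiable maps on a half space\<close>

lemma C2_onE:
  assumes "C2_on S f"
  obtains D D2 where
    "\<And>z. z \<in> S \<Longrightarrow> (f has_derivative blinfun_apply (D z)) (at z within S)"
    "\<And>z. z \<in> S \<Longrightarrow> (D has_derivative blinfun_apply (D2 z)) (at z within S)"
    "continuous_on S D2"
  using assms unfolding C2_on_def C1_on_def by metis

text \<open>
  The mixed second difference quotient of \<open>f\<close> in the directions \<open>h\<close> and \<open>k\<close> is a value of the second
  derivative: apply the mean value theorem first along \<open>h\<close> and then along \<open>k\<close>. The left-hand side is
  symmetric in \<open>h\<close> and \<open>k\<close>, the right-hand side is not obviously so.
\<close>

lemma second_difference_mean_value:
  fixes f :: "'a::real_normed_vector \<Rightarrow> real"
  assumes f: "\<And>y. y \<in> S \<Longrightarrow> (f has_derivative blinfun_apply (D y)) (at y)"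
    and D: "\<And>y. y \<in> S \<Longrightarrow> (D has_derivative blinfun_apply (D2 y)) (at y)"
    and "0 < s"
    and sub: "\<And>u w. \<lbrakk>0 \<le> u; u \<le> s; 0 \<le> w; w \<le> s\<rbrakk> \<Longrightarrow> z + u *\<^sub>R h + w *\<^sub>R k \<in> S"
  obtains u w where "0 < u" "u < s" "0 < w" "w < s"
    "f (z + s *\<^sub>R h + s *\<^sub>R k) - f (z + s *\<^sub>R h) - f (z + s *\<^sub>R k) + f z
      = s\<^sup>2 * D2 (z + u *\<^sub>R h + w *\<^sub>R k) k h"
proof -
  define g where "g u = f (z + u *\<^sub>R h + s *\<^sub>R k) - f (z + u *\<^sub>R h + 0 *\<^sub>R k)" for u
  have line: "((\<lambda>u. f (z + u *\<^sub>R h + w *\<^sub>R k)) has_real_derivative D (z + u *\<^sub>R h + w *\<^sub>R k) h) (at u)"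
    if "0 \<le> u" "u \<le> s" "0 \<le> w" "w \<le> s" for u w
  proof -
    have "((\<lambda>u. z + u *\<^sub>R h + w *\<^sub>R k) has_derivative (\<lambda>a. a *\<^sub>R h)) (at u)"
      by (auto intro!: derivative_eq_intros)
    from has_derivative_compose[OF this f[OF sub[OF that]]]
    show ?thesis
      by (rule has_derivative_imp_has_field_derivative) (simp add: blinfun.scaleR_right)
  qed
  have "\<exists>u. 0 < u \<and> u < s \<and> g s - g 0
      = (s - 0) * (D (z + u *\<^sub>R h + s *\<^sub>R k) h - D (z + u *\<^sub>R h + 0 *\<^sub>R k) h)"
    unfolding g_def using \<open>0 < s\<close> by (intro MVT2 DERIV_diff line) auto
  then obtain u where u: "0 < u" "u < s"
    "g s - g 0 = s * (D (z + u *\<^sub>R h + s *\<^sub>R k) h - D (z + u *\<^sub>R h + 0 *\<^sub>R k) h)"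
    by auto
  have line2: "((\<lambda>w. D (z + u *\<^sub>R h + w *\<^sub>R k) h) has_real_derivative
      D2 (z + u *\<^sub>R h + w *\<^sub>R k) k h) (at w)" if "0 \<le> w" "w \<le> s" for w
  proof -
    have "((\<lambda>w. z + u *\<^sub>R h + w *\<^sub>R k) has_derivative (\<lambda>a. a *\<^sub>R k)) (at w)"
      by (auto intro!: derivative_eq_intros)
    moreover have "z + u *\<^sub>R h + w *\<^sub>R k \<in> S"
      using sub u that by simp
    ultimately have "((\<lambda>w. D (z + u *\<^sub>R h + w *\<^sub>R k)) has_derivative
        (\<lambda>a. D2 (z + u *\<^sub>R h + w *\<^sub>R k) (a *\<^sub>R k))) (at w)"
      using has_derivative_compose D by blast
    then have "((\<lambda>w. D (z + u *\<^sub>R h + w *\<^sub>R k) h) has_derivative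
        (\<lambda>a. D2 (z + u *\<^sub>R h + w *\<^sub>R k) (a *\<^sub>R k) h)) (at w)"
      by (auto intro!: derivative_eq_intros)
    then show ?thesis
      by (rule has_derivative_imp_has_field_derivative) (simp add: blinfun.scaleR_right blinfun.scaleR_left)
  qed
  have "\<exists>w. 0 < w \<and> w < s \<and> D (z + u *\<^sub>R h + s *\<^sub>R k) h - D (z + u *\<^sub>R h + 0 *\<^sub>R k) h
      = (s - 0) * D2 (z + u *\<^sub>R h + w *\<^sub>R k) k h"
    using \<open>0 < s\<close> by (intro MVT2 line2) auto
  then obtain w where "0 < w" "w < s" "D (z + u *\<^sub>R h + s *\<^sub>R k) h - D (z + u *\<^sub>R h + 0 *\<^sub>R k) h
      = s * D2 (z + u *\<^sub>R h + w *\<^sub>R k) k h"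
    by auto
  then show thesis
    using that u by (auto simp: g_def power2_eq_square)
qed

text \<open>
  Exchanging \<open>h\<close> and \<open>k\<close> in the second difference shows that two values of the second derivative at
  points near \<open>z\<close> coincide, one with the arguments exchanged; continuity at \<open>z\<close> does the rest.
\<close>

lemma second_derivative_symmetric:
  fixes f :: "'a::real_normed_vector \<Rightarrow> real"
  assumes f: "\<And>y. y \<in> S \<Longrightarrow> (f has_derivative blinfun_apply (D y)) (at y)"
    and D: "\<And>y. y \<in> S \<Longrightarrow> (D has_derivative blinfun_apply (D2 y)) (at y)"
    and cont: "continuous_on S D2" and "open S" "z \<in> S"
  shows "D2 z h k = D2 z k h"
proof (rule ccontr)
  assume ne: "D2 z h k \<noteq> D2 z k h"
  define \<epsilon> where "\<epsilon> = dist (D2 z k h) (D2 z h k) / 2"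
  have "\<epsilon> > 0"
    using ne by (simp add: \<epsilon>_def)
  have near: "eventually (\<lambda>y. dist (D2 y a b) (D2 z a b) < \<epsilon>) (at z)" for a b
  proof -
    have "continuous_on S (\<lambda>y. D2 y a b)"
      by (intro continuous_intros cont)
    then have "((\<lambda>y. D2 y a b) \<longlongrightarrow> D2 z a b) (at z)"
      using \<open>open S\<close> \<open>z \<in> S\<close> by (simp add: continuous_on_eq_continuous_at isCont_def)
    then show ?thesis
      using \<open>\<epsilon> > 0\<close> by (rule tendstoD)
  qed
  have "eventually (\<lambda>y. y \<in> S \<and> dist (D2 y h k) (D2 z h k) < \<epsilon> \<and> dist (D2 y k h) (D2 z k h) < \<epsilon>) (at z)"
    using near eventually_at_in_open'[OF \<open>open S\<close> \<open>z \<in> S\<close>] by (simp add: eventually_conj_iff)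
  then obtain d where "d > 0" and d: "\<And>y. dist y z < d \<Longrightarrow>
      y \<in> S \<and> dist (D2 y h k) (D2 z h k) < \<epsilon> \<and> dist (D2 y k h) (D2 z k h) < \<epsilon>"
    using \<open>\<epsilon> > 0\<close> \<open>z \<in> S\<close> unfolding eventually_at by (metis UNIV_I dist_self)
  define N where "N = norm h + norm k + 1"
  \<comment> \<open>A step so small that the whole parallelogram spanned by \<open>s h\<close> and \<open>s k\<close> stays within distance \<open>d\<close>.\<close>
  define s where "s = d / N / 2"
  have pos: "N > 0"
    using norm_ge_zero[of h] norm_ge_zero[of k] unfolding N_def by linarith
  then have "s > 0"
    using \<open>d > 0\<close> by (simp add: s_def)
  have small: "dist (z + u *\<^sub>R h + w *\<^sub>R k) z < d" if "0 \<le> u" "u \<le> s" "0 \<le> w" "w \<le> s" for u w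
  proof -
    have "dist (z + u *\<^sub>R h + w *\<^sub>R k) z = norm (u *\<^sub>R h + w *\<^sub>R k)"
      by (simp add: dist_norm add.assoc)
    also have "\<dots> \<le> u * norm h + w * norm k"
      using norm_triangle_ineq[of "u *\<^sub>R h" "w *\<^sub>R k"] that by simp
    also have "\<dots> \<le> s * norm h + s * norm k"
      using that by (intro add_mono mult_right_mono) auto
    also have "\<dots> \<le> s * N"
      using \<open>s > 0\<close> by (simp add: algebra_simps N_def)
    also have "\<dots> = d / 2"
      using pos by (simp add: s_def)
    also have "\<dots> < d"
      using \<open>d > 0\<close> by simp
    finally show ?thesis .
  qed
  have swap: "z + u *\<^sub>R k + w *\<^sub>R h = z + w *\<^sub>R h + u *\<^sub>R k" for u w
    by simp
  have inS: "z + u *\<^sub>R h + w *\<^sub>R k \<in> S" if "0 \<le> u" "u \<le> s" "0 \<le> w" "w \<le> s" for u w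
    using d[OF small[OF that]] by blast
  have inS': "z + u *\<^sub>R k + w *\<^sub>R h \<in> S" if "0 \<le> u" "u \<le> s" "0 \<le> w" "w \<le> s" for u w
    unfolding swap using inS that by blast
  obtain u w where 1: "0 < u" "u < s" "0 < w" "w < s"
    "f (z + s *\<^sub>R h + s *\<^sub>R k) - f (z + s *\<^sub>R h) - f (z + s *\<^sub>R k) + f z
      = s\<^sup>2 * D2 (z + u *\<^sub>R h + w *\<^sub>R k) k h"
    by (rule second_difference_mean_value[OF f D \<open>s > 0\<close> inS])
  obtain u' w' where 2: "0 < u'" "u' < s" "0 < w'" "w' < s"
    "f (z + s *\<^sub>R k + s *\<^sub>R h) - f (z + s *\<^sub>R k) - f (z + s *\<^sub>R h) + f z
      = s\<^sup>2 * D2 (z + u' *\<^sub>R k + w' *\<^sub>R h) h k"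
    by (rule second_difference_mean_value[OF f D \<open>s > 0\<close> inS'])
  have "s\<^sup>2 * D2 (z + u *\<^sub>R h + w *\<^sub>R k) k h = s\<^sup>2 * D2 (z + w' *\<^sub>R h + u' *\<^sub>R k) h k"
    using 1(5) 2(5) unfolding swap by linarith
  then have eq: "D2 (z + u *\<^sub>R h + w *\<^sub>R k) k h = D2 (z + w' *\<^sub>R h + u' *\<^sub>R k) h k"
    using \<open>s > 0\<close> by simp
  have "dist (D2 (z + u *\<^sub>R h + w *\<^sub>R k) k h) (D2 z k h) < \<epsilon>"
    using d[OF small] 1 by simp
  moreover have "dist (D2 (z + u *\<^sub>R h + w *\<^sub>R k) k h) (D2 z h k) < \<epsilon>"
    unfolding eq using d[OF small] 2 by simp
  ultimately have "dist (D2 z k h) (D2 z h k) < dist (D2 z k h) (D2 z h k)"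
    unfolding \<epsilon>_def by (rule dist_triangle_half_r)
  then show False
    by simp
qed

lemma open_half_space: "open {(t :: real, r :: real, p :: real). 0 < r}"
proof -
  have "{(t, r, p). 0 < r} = (\<lambda>z :: real \<times> real \<times> real. fst (snd z)) -` {0<..}"
    by auto
  also have "open \<dots>"
    by (intro open_vimage) (auto intro!: continuous_intros)
  finally show ?thesis .
qed

lemma has_derivative_at_interior_half_space:
  fixes g :: "real \<times> real \<times> real \<Rightarrow> real"
  assumes "(g has_derivative g') (at (t, r, p) within {(t, r, p). 0 \<le> r})" and "0 < r"
  shows "(g has_derivative g') (at (t, r, p))"
proof -
  have "at (t, r, p) within {(t, r, p). 0 \<le> r} = at (t, r, p)"
    using \<open>0 < r\<close> by (intro at_within_open_subset[OF _ open_half_space]) auto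
  then show ?thesis
    using assms(1) by simp
qed

lemma zero_of_finite_slope:
  fixes g :: "real \<Rightarrow> real"
  assumes "continuous_on {0..} g" "((\<lambda>r. g r / r) \<longlongrightarrow> l) (at_right 0)"
  shows "g 0 = 0"
proof -
  have "(g \<longlongrightarrow> g 0) (at_right 0)"
    using assms(1) by (auto simp: continuous_on_def intro: tendsto_within_subset)
  moreover have "((\<lambda>r. g r / r * r) \<longlongrightarrow> l * 0) (at_right 0)"
    by (intro tendsto_intros assms(2))
  then have "((\<lambda>r. g r / r * r) \<longlongrightarrow> 0) (at_right 0)"
    by (simp only: mult_zero_right)
  then have "(g \<longlongrightarrow> 0) (at_right 0)"
    by (rule Lim_transform_eventually) (auto simp: eventually_at_right_less eventually_at_filter)
  ultimately show ?thesis
    by (rule tendsto_unique[rotated]) simp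
qed

text \<open>
  Coordinates for the regularity of \<open>R\<close> and \<open>P\<close>. First derivatives are needed up to the boundary
  \<open>r = 0\<close>, second derivatives only inside, where the mixed ones commute.
\<close>

lemma half_space_partials:
  assumes "C2_on {(t, r, p). 0 \<le> r} (\<lambda>(t, r, p). R t r p)"
  obtains Rt Rr Rp Rtt Rtr Rtp :: "real \<Rightarrow> real \<Rightarrow> real \<Rightarrow> real" where
    "\<And>t r p. 0 \<le> r \<Longrightarrow> ((\<lambda>(t, r, p). R t r p) has_derivative
       (\<lambda>(a, b, c). a * Rt t r p + b * Rr t r p + c * Rp t r p)) (at (t, r, p) within {(t, r, p). 0 \<le> r})"
    "continuous_on {(t, r, p). 0 \<le> r} (\<lambda>(t, r, p). Rr t r p)"
    "continuous_on {(t, r, p). 0 \<le> r} (\<lambda>(t, r, p). Rp t r p)"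
    "\<And>t r p. 0 < r \<Longrightarrow> ((\<lambda>s. Rt s r p) has_real_derivative Rtt t r p) (at t)"
    "\<And>t r p. 0 < r \<Longrightarrow> ((\<lambda>s. Rr s r p) has_real_derivative Rtr t r p) (at t)"
    "\<And>t r p. 0 < r \<Longrightarrow> ((\<lambda>s. Rt t s p) has_real_derivative Rtr t r p) (at r)"
    "\<And>t r p. 0 < r \<Longrightarrow> ((\<lambda>s. Rp s r p) has_real_derivative Rtp t r p) (at t)"
    "\<And>t r p. 0 < r \<Longrightarrow> ((\<lambda>s. Rt t r s) has_real_derivative Rtp t r p) (at p)"
proof -
  let ?S = "{(t, r, p). 0 \<le> r} :: (real \<times> real \<times> real) set"
  let ?T = "{(t, r, p). 0 < r} :: (real \<times> real \<times> real) set"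
  let ?R = "\<lambda>(t, r, p). R t r p"
  obtain D D2 where D: "\<And>z. z \<in> ?S \<Longrightarrow> (?R has_derivative blinfun_apply (D z)) (at z within ?S)"
    and D2: "\<And>z. z \<in> ?S \<Longrightarrow> (D has_derivative blinfun_apply (D2 z)) (at z within ?S)"
    and cont: "continuous_on ?S D2"
    using C2_onE[OF assms] by metis
  have "open ?T"
    by (rule open_half_space)
  have "?T \<subseteq> ?S"
    by auto
  have within: "at z within ?S = at z" if "z \<in> ?T" for z
    using at_within_open_subset[OF that \<open>open ?T\<close> \<open>?T \<subseteq> ?S\<close>] .
  have DT: "(?R has_derivative blinfun_apply (D z)) (at z)" if "z \<in> ?T" for z
    using D[OF subsetD[OF \<open>?T \<subseteq> ?S\<close> that]] unfolding within[OF that] .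
  have D2T: "(D has_derivative blinfun_apply (D2 z)) (at z)" if "z \<in> ?T" for z
    using D2[OF subsetD[OF \<open>?T \<subseteq> ?S\<close> that]] unfolding within[OF that] .
  have sym: "D2 z h k = D2 z k h" if "z \<in> ?T" for z h k
    using DT D2T continuous_on_subset[OF cont \<open>?T \<subseteq> ?S\<close>] \<open>open ?T\<close> that
    by (rule second_derivative_symmetric)
  have contD: "continuous_on ?S D"
    using D2 by (rule has_derivative_continuous_on)
  have contk: "continuous_on ?S (\<lambda>z. D z k)" for k
    by (intro continuous_intros contD)
  have coord: "((\<lambda>u. D (g u) k) has_real_derivative D2 (g u) h k) (at u)"
    if "(g has_derivative (\<lambda>a. a *\<^sub>R h)) (at u)" "g u \<in> ?T" for g u h k
  proof -
    have "((\<lambda>u. D (g u)) has_derivative (\<lambda>a. D2 (g u) (a *\<^sub>R h))) (at u)"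
      using has_derivative_compose[OF that(1) D2T[OF that(2)]] .
    then have "((\<lambda>u. D (g u) k) has_derivative (\<lambda>a. D2 (g u) (a *\<^sub>R h) k)) (at u)"
      by (auto intro!: derivative_eq_intros)
    then show ?thesis
      by (rule has_derivative_imp_has_field_derivative) (simp add: blinfun.scaleR_right blinfun.scaleR_left)
  qed
  have ct: "((\<lambda>s. D (s, r, p) k) has_real_derivative D2 (t, r, p) (1, 0, 0) k) (at t)"
    if "0 < r" for t r p k
    using that by (intro coord) (auto intro!: derivative_eq_intros simp: zero_prod_def)
  have cr: "((\<lambda>s. D (t, s, p) k) has_real_derivative D2 (t, r, p) (0, 1, 0) k) (at r)"
    if "0 < r" for t r p k
    using that by (intro coord) (auto intro!: derivative_eq_intros simp: zero_prod_def)
  have cp: "((\<lambda>s. D (t, r, s) k) has_real_derivative D2 (t, r, p) (0, 0, 1) k) (at p)"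
    if "0 < r" for t r p k
    using that by (intro coord) (auto intro!: derivative_eq_intros simp: zero_prod_def)
  show thesis
  proof (rule that[of "\<lambda>t r p. D (t, r, p) (1, 0, 0)" "\<lambda>t r p. D (t, r, p) (0, 1, 0)"
        "\<lambda>t r p. D (t, r, p) (0, 0, 1)" "\<lambda>t r p. D2 (t, r, p) (1, 0, 0) (1, 0, 0)"
        "\<lambda>t r p. D2 (t, r, p) (1, 0, 0) (0, 1, 0)" "\<lambda>t r p. D2 (t, r, p) (1, 0, 0) (0, 0, 1)"])
    fix t r p :: real
    show "(?R has_derivative (\<lambda>(a, b, c). a * D (t, r, p) (1, 0, 0) + b * D (t, r, p) (0, 1, 0)
        + c * D (t, r, p) (0, 0, 1))) (at (t, r, p) within ?S)" if "0 \<le> r"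
    proof -
      have "blinfun_apply (D (t, r, p)) = (\<lambda>(a, b, c). a * D (t, r, p) (1, 0, 0)
        + b * D (t, r, p) (0, 1, 0) + c * D (t, r, p) (0, 0, 1))"
      proof (rule ext, clarify)
        fix a b c :: real
        have "(a, b, c) = a *\<^sub>R (1, 0, 0) + b *\<^sub>R (0, 1, 0) + c *\<^sub>R (0, 0, 1::real)"
          by simp
        then show "D (t, r, p) (a, b, c) = a * D (t, r, p) (1, 0, 0) + b * D (t, r, p) (0, 1, 0)
            + c * D (t, r, p) (0, 0, 1)"
          by (simp only: blinfun.add_right blinfun.scaleR_right real_scaleR_def)
      qed
      then show ?thesis
        using D[of "(t, r, p)"] that by simp
    qed
  next
    show "continuous_on ?S (\<lambda>(t, r, p). D (t, r, p) (0, 1, 0))"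
      "continuous_on ?S (\<lambda>(t, r, p). D (t, r, p) (0, 0, 1))"
      using contk by (auto simp: split_def)
  next
    fix t r p :: real
    assume r: "0 < r"
    have s1: "D2 (t, r, p) (1, 0, 0) (0, 1, 0) = D2 (t, r, p) (0, 1, 0) (1, 0, 0)"
      and s2: "D2 (t, r, p) (1, 0, 0) (0, 0, 1) = D2 (t, r, p) (0, 0, 1) (1, 0, 0)"
      using r by (auto intro: sym)
    show "((\<lambda>s. D (s, r, p) (1, 0, 0)) has_real_derivative D2 (t, r, p) (1, 0, 0) (1, 0, 0)) (at t)"
      "((\<lambda>s. D (s, r, p) (0, 1, 0)) has_real_derivative D2 (t, r, p) (1, 0, 0) (0, 1, 0)) (at t)"
      "((\<lambda>s. D (s, r, p) (0, 0, 1)) has_real_derivative D2 (t, r, p) (1, 0, 0) (0, 0, 1)) (at t)"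
      by (rule ct[OF r])+
    show "((\<lambda>s. D (t, s, p) (1, 0, 0)) has_real_derivative D2 (t, r, p) (1, 0, 0) (0, 1, 0)) (at r)"
      unfolding s1 by (rule cr[OF r])
    show "((\<lambda>s. D (t, r, s) (1, 0, 0)) has_real_derivative D2 (t, r, p) (1, 0, 0) (0, 0, 1)) (at p)"
      unfolding s2 by (rule cp[OF r])
  qed
qed

lemma half_plane_partials:
  assumes "C2_on {(r, p). 0 < r} (\<lambda>(r, p). h r p)"
  obtains hr hp hrr hrp hpp :: "real \<Rightarrow> real \<Rightarrow> real" where
    "\<And>r p. 0 < r \<Longrightarrow> ((\<lambda>s. h s p) has_real_derivative hr r p) (at r)"
    "\<And>r p. 0 < r \<Longrightarrow> ((\<lambda>s. h r s) has_real_derivative hp r p) (at p)"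
    "\<And>r p. 0 < r \<Longrightarrow> ((\<lambda>(r, p). hr r p) has_derivative (\<lambda>(a, b). a * hrr r p + b * hrp r p)) (at (r, p))"
    "\<And>r p. 0 < r \<Longrightarrow> ((\<lambda>(r, p). hp r p) has_derivative (\<lambda>(a, b). a * hrp r p + b * hpp r p)) (at (r, p))"
proof -
  let ?T = "{(r, p). 0 < r} :: (real \<times> real) set"
  let ?h = "\<lambda>(r, p). h r p"
  have "?T = fst -` {0<..}"
    by auto
  also have "open \<dots>"
    by (intro open_vimage) (auto intro!: continuous_intros)
  finally have "open ?T" .
  obtain D D2 where D: "\<And>z. z \<in> ?T \<Longrightarrow> (?h has_derivative blinfun_apply (D z)) (at z)"
    and D2: "\<And>z. z \<in> ?T \<Longrightarrow> (D has_derivative blinfun_apply (D2 z)) (at z)"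
    and cont: "continuous_on ?T D2"
    using C2_onE[OF assms] \<open>open ?T\<close> by (metis at_within_open)
  have sym: "D2 z h k = D2 z k h" if "z \<in> ?T" for z h k
    using D D2 cont \<open>open ?T\<close> that by (rule second_derivative_symmetric)
  have lin: "(a, b) = a *\<^sub>R (1, 0) + b *\<^sub>R (0, 1::real)" for a b
    by simp
  have D2k: "((\<lambda>(r, p). D (r, p) k) has_derivative
      (\<lambda>(a, b). a * D2 (r, p) (1, 0) k + b * D2 (r, p) (0, 1) k)) (at (r, p))" if "0 < r" for r p k
  proof -
    have "((\<lambda>z. D z k) has_derivative (\<lambda>h. D2 (r, p) h k)) (at (r, p))"
      using D2[of "(r, p)"] that by (auto intro!: derivative_eq_intros)
    moreover have "(\<lambda>h. D2 (r, p) h k) = (\<lambda>(a, b). a * D2 (r, p) (1, 0) k + b * D2 (r, p) (0, 1) k)"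
    proof (rule ext, clarify)
      fix a b :: real
      show "D2 (r, p) (a, b) k = a * D2 (r, p) (1, 0) k + b * D2 (r, p) (0, 1) k"
        by (subst lin) (simp only: blinfun.add_right blinfun.scaleR_right blinfun.add_left
            blinfun.scaleR_left real_scaleR_def)
    qed
    ultimately show ?thesis
      by (simp add: split_def)
  qed
  have coord: "((\<lambda>u. ?h (g u)) has_real_derivative D (g u) k) (at u)"
    if "(g has_derivative (\<lambda>a. a *\<^sub>R k)) (at u)" "g u \<in> ?T" for g u k
    using has_derivative_compose[OF that(1) D[OF that(2)]]
    by (rule has_derivative_imp_has_field_derivative) (simp add: blinfun.scaleR_right)
  show thesis
  proof (rule that[of "\<lambda>r p. D (r, p) (1, 0)" "\<lambda>r p. D (r, p) (0, 1)"
        "\<lambda>r p. D2 (r, p) (1, 0) (1, 0)" "\<lambda>r p. D2 (r, p) (1, 0) (0, 1)" "\<lambda>r p. D2 (r, p) (0, 1) (0, 1)"])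
    fix r p :: real
    assume r: "0 < r"
    show "((\<lambda>s. h s p) has_real_derivative D (r, p) (1, 0)) (at r)"
    proof -
      have "((\<lambda>s. ?h (s, p)) has_real_derivative D (r, p) (1, 0)) (at r)"
        using r by (intro coord) (auto intro!: derivative_eq_intros simp: zero_prod_def)
      then show ?thesis
        by simp
    qed
    show "((\<lambda>s. h r s) has_real_derivative D (r, p) (0, 1)) (at p)"
    proof -
      have "((\<lambda>s. ?h (r, s)) has_real_derivative D (r, p) (0, 1)) (at p)"
        using r by (intro coord) (auto intro!: derivative_eq_intros simp: zero_prod_def)
      then show ?thesis
        by simp
    qed
    show "((\<lambda>(r, p). D (r, p) (1, 0)) has_derivative
        (\<lambda>(a, b). a * D2 (r, p) (1, 0) (1, 0) + b * D2 (r, p) (1, 0) (0, 1))) (at (r, p))"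
      using D2k[OF r, where k = "(1, 0)" and p = p] sym[of "(r, p)" "(1, 0)" "(0, 1)"] r by simp
    show "((\<lambda>(r, p). D (r, p) (0, 1)) has_derivative
        (\<lambda>(a, b). a * D2 (r, p) (1, 0) (0, 1) + b * D2 (r, p) (0, 1) (0, 1))) (at (r, p))"
      using D2k[OF r, where k = "(0, 1)" and p = p] by simp
  qed
qed

section \<open>Hamiltonian flows preserve the Jacobian\<close>

lemma partials_of_derivative:
  assumes "((\<lambda>(t, r, p). R t r p) has_derivative (\<lambda>(a, b, c). a * Rt + b * Rr + c * Rp)) (at (t, r, p))"
  shows "((\<lambda>s. R s r p) has_real_derivative Rt) (at t)"
    "((\<lambda>s. R t s p) has_real_derivative Rr) (at r)"
    "((\<lambda>s. R t r s) has_real_derivative Rp) (at p)"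
proof -
  have "((\<lambda>s. (s, r, p)) has_derivative (\<lambda>a. (a, 0, 0))) (at t)"
    "((\<lambda>s. (t, s, p)) has_derivative (\<lambda>a. (0, a, 0))) (at r)"
    "((\<lambda>s. (t, r, s)) has_derivative (\<lambda>a. (0, 0, a))) (at p)"
    by (auto intro!: derivative_eq_intros simp: zero_prod_def)
  from this[THEN has_derivative_compose, OF assms] show
    "((\<lambda>s. R s r p) has_real_derivative Rt) (at t)"
    "((\<lambda>s. R t s p) has_real_derivative Rr) (at r)"
    "((\<lambda>s. R t r s) has_real_derivative Rp) (at p)"
    by (auto intro!: has_derivative_imp_has_field_derivative)
qed

text \<open>
  The chain rule in the form in which it is used to differentiate Hamilton's equations: an outer
  function of two variables along a curve.
\<close>

lemma has_real_derivative_compose_pair: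
  assumes "((\<lambda>(x, y). h x y) has_derivative (\<lambda>(a, b). a * hx + b * hy)) (at (f u, g u))"
    and "(f has_real_derivative f') (at u)" "(g has_real_derivative g') (at u)"
  shows "((\<lambda>s. h (f s) (g s)) has_real_derivative f' * hx + g' * hy) (at u)"
proof -
  have "((\<lambda>s. (f s, g s)) has_derivative (\<lambda>a. (f' * a, g' * a))) (at u)"
    using assms(2,3) by (auto intro!: has_derivative_Pair simp: has_field_derivative_def)
  from has_derivative_compose[OF this] assms(1)
  have "((\<lambda>s. h (f s) (g s)) has_derivative (\<lambda>a. f' * a * hx + g' * a * hy)) (at u)"
    by fastforce
  then show ?thesis
    by (rule has_derivative_imp_has_field_derivative) (simp add: algebra_simps)
qed

text \<open>
  Liouville's theorem in one degree of freedom. Writing \<open>\<partial>\<^sub>t R = \<partial>\<^sub>p H(R, P)\<close> and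
  \<open>\<partial>\<^sub>t P = - \<partial>\<^sub>r H(R, P)\<close>, the time derivative of the Jacobian is the Jacobian times
  \<open>\<partial>\<^sub>r \<partial>\<^sub>p H - \<partial>\<^sub>p \<partial>\<^sub>r H = 0\<close>. The mixed derivatives of \<open>R\<close> and \<open>P\<close> commute as well, so that
  \<open>\<partial>\<^sub>t \<partial>\<^sub>r R\<close> may be computed by differentiating Hamilton's equation in \<open>r\<close>.
\<close>

lemma hamiltonian_flow_jacobian_constant:
  assumes R: "\<And>t r p. 0 < r \<Longrightarrow> ((\<lambda>(t, r, p). R t r p) has_derivative
       (\<lambda>(a, b, c). a * Rt t r p + b * Rr t r p + c * Rp t r p)) (at (t, r, p))"
    and P: "\<And>t r p. 0 < r \<Longrightarrow> ((\<lambda>(t, r, p). P t r p) has_derivative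
       (\<lambda>(a, b, c). a * Pt t r p + b * Pr t r p + c * Pp t r p)) (at (t, r, p))"
    and mixedR: "\<And>t r p. 0 < r \<Longrightarrow> ((\<lambda>s. Rr s r p) has_real_derivative Rtr t r p) (at t)"
    "\<And>t r p. 0 < r \<Longrightarrow> ((\<lambda>s. Rt t s p) has_real_derivative Rtr t r p) (at r)"
    "\<And>t r p. 0 < r \<Longrightarrow> ((\<lambda>s. Rp s r p) has_real_derivative Rtp t r p) (at t)"
    "\<And>t r p. 0 < r \<Longrightarrow> ((\<lambda>s. Rt t r s) has_real_derivative Rtp t r p) (at p)"
    and mixedP: "\<And>t r p. 0 < r \<Longrightarrow> ((\<lambda>s. Pr s r p) has_real_derivative Ptr t r p) (at t)"
    "\<And>t r p. 0 < r \<Longrightarrow> ((\<lambda>s. Pt t s p) has_real_derivative Ptr t r p) (at r)"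
    "\<And>t r p. 0 < r \<Longrightarrow> ((\<lambda>s. Pp s r p) has_real_derivative Ptp t r p) (at t)"
    "\<And>t r p. 0 < r \<Longrightarrow> ((\<lambda>s. Pt t r s) has_real_derivative Ptp t r p) (at p)"
    and H: "\<And>t. C2_on {(r, p). 0 < r} (\<lambda>(r, p). H t r p)"
    and hamilton_R: "\<And>t r p. 0 < r \<Longrightarrow>
          ((\<lambda>s. R s r p) has_real_derivative deriv (\<lambda>q. H t (R t r p) q) (P t r p)) (at t)"
    and hamilton_P: "\<And>t r p. 0 < r \<Longrightarrow>
          ((\<lambda>s. P s r p) has_real_derivative - deriv (\<lambda>q. H t q (P t r p)) (R t r p)) (at t)"
    and R_pos: "\<And>t r p. 0 < r \<Longrightarrow> 0 < R t r p"
    and "0 < r"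
  shows "Rr t r p * Pp t r p - Rp t r p * Pr t r p = Rr 0 r p * Pp 0 r p - Rp 0 r p * Pr 0 r p"
proof (rule DERIV_isconst_all[of "\<lambda>t. Rr t r p * Pp t r p - Rp t r p * Pr t r p"], intro allI)
  fix t
  obtain hr hp hrr hrp hpp where
    hr: "\<And>r p. 0 < r \<Longrightarrow> ((\<lambda>s. H t s p) has_real_derivative hr r p) (at r)" and
    hp: "\<And>r p. 0 < r \<Longrightarrow> ((\<lambda>s. H t r s) has_real_derivative hp r p) (at p)" and
    hr': "\<And>r p. 0 < r \<Longrightarrow> ((\<lambda>(r, p). hr r p) has_derivative (\<lambda>(a, b). a * hrr r p + b * hrp r p)) (at (r, p))" and
    hp': "\<And>r p. 0 < r \<Longrightarrow> ((\<lambda>(r, p). hp r p) has_derivative (\<lambda>(a, b). a * hrp r p + b * hpp r p)) (at (r, p))"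
    using half_plane_partials[OF H[of t]] by metis
  have Rt: "Rt t r p = hp (R t r p) (P t r p)" if "0 < r" for r p
    using DERIV_unique[OF hamilton_R[OF that, where t = t and p = p] partials_of_derivative(1)[OF R[OF that, where t = t and p = p]]]
      DERIV_imp_deriv[OF hp[OF R_pos[OF that, where t = t and p = p], of "P t r p"]] by simp
  have Pt: "Pt t r p = - hr (R t r p) (P t r p)" if "0 < r" for r p
    using DERIV_unique[OF hamilton_P[OF that, where t = t and p = p] partials_of_derivative(1)[OF P[OF that, where t = t and p = p]]]
      DERIV_imp_deriv[OF hr[OF R_pos[OF that, where t = t and p = p], of "P t r p"]] by simp
  have near: "eventually (\<lambda>s. 0 < s) (nhds r)"
    using eventually_nhds_in_open[of "{0<..}" r] \<open>0 < r\<close> by simp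
  let ?hrr = "hrr (R t r p) (P t r p)" and ?hrp = "hrp (R t r p) (P t r p)" and ?hpp = "hpp (R t r p) (P t r p)"
  note dR = partials_of_derivative[OF R[OF \<open>0 < r\<close>, where t = t and p = p]]
  note dP = partials_of_derivative[OF P[OF \<open>0 < r\<close>, where t = t and p = p]]
  note hr'' = hr'[OF R_pos[OF \<open>0 < r\<close>, where t = t and p = p], of "P t r p"]
  note hp'' = hp'[OF R_pos[OF \<open>0 < r\<close>, where t = t and p = p], of "P t r p"]
  have "((\<lambda>s. Rt t s p) has_real_derivative Rr t r p * ?hrp + Pr t r p * ?hpp) (at r)"
    using has_real_derivative_compose_pair[OF hp'' dR(2) dP(2)]
    by (rule DERIV_cong_ev[THEN iffD1, rotated 3]) (use near Rt in \<open>auto elim: eventually_mono\<close>)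
  then have Rtr: "Rtr t r p = Rr t r p * ?hrp + Pr t r p * ?hpp"
    using mixedR(2)[OF \<open>0 < r\<close>] DERIV_unique by blast
  have "((\<lambda>s. Pt t s p) has_real_derivative - (Rr t r p * ?hrr + Pr t r p * ?hrp)) (at r)"
    using DERIV_minus[OF has_real_derivative_compose_pair[OF hr'' dR(2) dP(2)]]
    by (rule DERIV_cong_ev[THEN iffD1, rotated 3]) (use near Pt in \<open>auto elim: eventually_mono\<close>)
  then have Ptr: "Ptr t r p = - (Rr t r p * ?hrr + Pr t r p * ?hrp)"
    using mixedP(2)[OF \<open>0 < r\<close>] DERIV_unique by blast
  have "((\<lambda>s. Rt t r s) has_real_derivative Rp t r p * ?hrp + Pp t r p * ?hpp) (at p)"
    using has_real_derivative_compose_pair[OF hp'' dR(3) dP(3)] by (simp add: Rt[OF \<open>0 < r\<close>])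
  then have Rtp: "Rtp t r p = Rp t r p * ?hrp + Pp t r p * ?hpp"
    using mixedR(4)[OF \<open>0 < r\<close>] DERIV_unique by blast
  have "((\<lambda>s. Pt t r s) has_real_derivative - (Rp t r p * ?hrr + Pp t r p * ?hrp)) (at p)"
    using DERIV_minus[OF has_real_derivative_compose_pair[OF hr'' dR(3) dP(3)]]
    by (simp add: Pt[OF \<open>0 < r\<close>])
  then have Ptp: "Ptp t r p = - (Rp t r p * ?hrr + Pp t r p * ?hrp)"
    using mixedP(4)[OF \<open>0 < r\<close>] DERIV_unique by blast
  have "((\<lambda>t. Rr t r p * Pp t r p - Rp t r p * Pr t r p) has_real_derivative
      (Rtr t r p * Pp t r p + Ptp t r p * Rr t r p) - (Rtp t r p * Pr t r p + Ptr t r p * Rp t r p)) (at t)"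
    by (intro DERIV_diff DERIV_mult mixedR mixedP \<open>0 < r\<close>)
  also have "(Rtr t r p * Pp t r p + Ptp t r p * Rr t r p) - (Rtp t r p * Pr t r p + Ptr t r p * Rp t r p) = 0"
    unfolding Rtr Rtp Ptr Ptp by algebra
  finally show "((\<lambda>t. Rr t r p * Pp t r p - Rp t r p * Pr t r p) has_real_derivative 0) (at t)" .
qed

section \<open>Solutions of the transport equations are linear\<close>

lemma quadratic_zero_coefficients:
  fixes a b c x h :: real
  assumes "h \<noteq> 0" "a + b * x + c * x\<^sup>2 = 0" "a + b * (x + h) + c * (x + h)\<^sup>2 = 0"
    "a + b * (x + 2 * h) + c * (x + 2 * h)\<^sup>2 = 0"
  shows "a = 0" "b = 0" "c = 0"
proof -
  have "2 * h\<^sup>2 * c = 0"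
    using assms(2-4) by algebra
  then show "c = 0"
    using assms(1) by simp
  then have "h * b = 0"
    using assms(2,3) by (simp add: distrib_left) algebra
  then show "b = 0"
    using assms(1) by simp
  then show "a = 0"
    using \<open>c = 0\<close> assms(2) by simp
qed

text \<open>
  As \<open>R\<close> does not depend on \<open>p\<close> in the box \<open>B\<close>, neither do \<open>\<partial>\<^sub>t R\<close>, \<open>\<partial>\<^sub>r R\<close> and \<open>\<partial>\<^sub>p P = 1 / \<partial>\<^sub>r R\<close>. So
  the equation \<open>R_eq\<close> is affine in \<open>p\<close>, and its slope in \<open>p\<close> gives \<open>R\<^sup>3 = (r \<partial>\<^sub>r R)\<^sup>3\<close>. Hence \<open>R / r\<close>
  depends on time only, and solving \<open>R_eq\<close> for \<open>P\<close> gives the last claim.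
\<close>

lemma linear_of_transport_equations:
  fixes R P Rt Rr Pp :: "real \<Rightarrow> real \<Rightarrow> real \<Rightarrow> real" and r0 p0 \<epsilon> :: real
  defines "c \<equiv> \<lambda>t. R t r0 p0 / r0" and "c' \<equiv> \<lambda>t. Rt t r0 p0 / r0"
  assumes Rt: "\<And>t r p. B t r p \<Longrightarrow> ((\<lambda>s. R s r p) has_real_derivative Rt t r p) (at t)"
    and Rr: "\<And>t r p. B t r p \<Longrightarrow> ((\<lambda>s. R t s p) has_real_derivative Rr t r p) (at r)"
    and Rp: "\<And>t r p. B t r p \<Longrightarrow> ((\<lambda>s. R t r s) has_real_derivative 0) (at p)"
    and Pp: "\<And>t r p. B t r p \<Longrightarrow> ((\<lambda>s. P t r s) has_real_derivative Pp t r p) (at p)"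
    and jac: "\<And>t r p. B t r p \<Longrightarrow> Rr t r p * Pp t r p = 1"
    and R_eq: "\<And>t r p. B t r p \<Longrightarrow> P t r p * Pp t r p * R t r p ^ 3 = r ^ 3 * (Rt t r p + p * Rr t r p)"
    and pos: "\<And>t r p. B t r p \<Longrightarrow> 0 < r \<and> 0 < R t r p"
    and B: "\<And>t r p. B t r p \<longleftrightarrow> \<bar>t - t0\<bar> < \<epsilon> \<and> \<bar>r - r0\<bar> < \<epsilon> \<and> \<bar>p - p0\<bar> < \<epsilon>"
    and "B t r p"
  shows "0 < c t" "R t r p = c t * r" "(c has_real_derivative c' t) (at t)"
    "P t r p = p / c t + r * c' t / (c t)\<^sup>2"
proof -
  let ?T = "{t0 - \<epsilon> <..< t0 + \<epsilon>}" and ?X = "{r0 - \<epsilon> <..< r0 + \<epsilon>}" and ?Y = "{p0 - \<epsilon> <..< p0 + \<epsilon>}"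
  have B': "B t r p \<longleftrightarrow> t \<in> ?T \<and> r \<in> ?X \<and> p \<in> ?Y" for t r p
    unfolding B by auto
  have "\<epsilon> > 0"
    using \<open>B t r p\<close> unfolding B by linarith
  then have center: "r0 \<in> ?X" "p0 \<in> ?Y"
    by auto
  have R_p: "R t r p = R t r p0" if "B t r p" for t r p
  proof (rule DERIV_isconst3[of "p0 - \<epsilon>" "p0 + \<epsilon>" p p0 "\<lambda>s. R t r s"])
    show "p0 - \<epsilon> < p0 + \<epsilon>" "p \<in> ?Y" "p0 \<in> ?Y"
      using that center \<open>\<epsilon> > 0\<close> by (auto simp: B')
    show "((\<lambda>s. R t r s) has_real_derivative 0) (at x)" if "x \<in> ?Y" for x
      using that \<open>B t r p\<close> by (intro Rp) (auto simp: B')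
  qed
  have at_p0: "B t r p0" if "B t r p" for t r p
    using that center by (simp add: B')
  have Rr_p: "Rr t r p = Rr t r p0" if "B t r p" for t r p
  proof -
    have "eventually (\<lambda>s. s \<in> ?X) (nhds r)"
      using that by (intro eventually_nhds_in_open) (auto simp: B')
    then have ev: "eventually (\<lambda>s. R t s p = R t s p0) (nhds r)"
      by (rule eventually_mono) (use that in \<open>auto simp: B' intro: R_p\<close>)
    show ?thesis
      using Rr[OF that] Rr[OF at_p0[OF that]] DERIV_cong_ev[OF refl ev refl] DERIV_unique by blast
  qed
  have Rt_p: "Rt t r p = Rt t r p0" if "B t r p" for t r p
  proof -
    have "eventually (\<lambda>s. s \<in> ?T) (nhds t)"
      using that by (intro eventually_nhds_in_open) (auto simp: B')
    then have ev: "eventually (\<lambda>s. R s r p = R s r p0) (nhds t)"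
      by (rule eventually_mono) (use that in \<open>auto simp: B' intro: R_p\<close>)
    show ?thesis
      using Rt[OF that] Rt[OF at_p0[OF that]] DERIV_cong_ev[OF refl ev refl] DERIV_unique by blast
  qed
  have R_rRr: "R t r p = r * Rr t r p" if "B t r p" for t r p
  proof -
    \<comment> \<open>The equation \<open>R_eq\<close> with the factors that do not depend on \<open>p\<close> frozen: it vanishes identically in
      \<open>q\<close>, and so does its derivative.\<close>
    let ?k = "Pp t r p" and ?g = "\<lambda>q. P t r q * Pp t r p * R t r p ^ 3 - r ^ 3 * (Rt t r p + q * Rr t r p)"
    have "eventually (\<lambda>q. q \<in> ?Y) (nhds p)"
      using that by (intro eventually_nhds_in_open) (auto simp: B')
    then have ev: "eventually (\<lambda>q. ?g q = 0) (nhds p)"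
    proof (rule eventually_mono)
      fix q assume "q \<in> ?Y"
      then have q: "B t r q"
        using that by (simp add: B')
      have same: "Rr t r q = Rr t r p" "Rt t r q = Rt t r p" "R t r q = R t r p"
        using Rr_p Rt_p R_p q that by metis+
      then have "Pp t r q = ?k"
        using jac[OF q] jac[OF that] by (metis mult_left_cancel mult_zero_left zero_neq_one)
      then show "?g q = 0"
        using R_eq[OF q] same by simp
    qed
    have "(?g has_real_derivative ?k * ?k * R t r p ^ 3 - r ^ 3 * Rr t r p) (at p)"
      by (auto intro!: derivative_eq_intros Pp[OF that])
    then have "((\<lambda>q. 0) has_real_derivative ?k * ?k * R t r p ^ 3 - r ^ 3 * Rr t r p) (at p)"
      using DERIV_cong_ev[OF refl ev refl] by blast
    then have "?k * ?k * R t r p ^ 3 - r ^ 3 * Rr t r p = 0"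
      using DERIV_unique DERIV_const by blast
    then have "(r * Rr t r p) ^ 3 = R t r p ^ 3"
      using jac[OF that] by algebra
    then have "root 3 ((r * Rr t r p) ^ 3) = root 3 (R t r p ^ 3)"
      by (rule arg_cong)
    moreover have odd: "odd (3 :: nat)"
      by simp
    ultimately show ?thesis
      by (simp only: odd_real_root_power_cancel[OF odd])
  qed
  have R_lin: "R t r p = c t * r" if "B t r p" for t r p
  proof -
    have "R t r p0 / r = R t r0 p0 / r0"
    proof (rule DERIV_isconst3[of "r0 - \<epsilon>" "r0 + \<epsilon>" r r0 "\<lambda>s. R t s p0 / s"])
      show "r0 - \<epsilon> < r0 + \<epsilon>" "r \<in> ?X" "r0 \<in> ?X"
        using that center \<open>\<epsilon> > 0\<close> by (auto simp: B')
      fix x assume "x \<in> ?X"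
      then have x: "B t x p0"
        using that center by (simp add: B')
      have "((\<lambda>s. R t s p0 / s) has_real_derivative (Rr t x p0 * x - R t x p0 * 1) / (x * x)) (at x)"
        using pos[OF x] by (intro DERIV_divide Rr[OF x] DERIV_ident) simp
      then show "((\<lambda>s. R t s p0 / s) has_real_derivative 0) (at x)"
        by (simp add: R_rRr[OF x])
    qed
    then show ?thesis
      using R_p[OF that] pos[OF that] by (simp add: c_def field_simps)
  qed
  show lin: "R t r p = c t * r"
    using R_lin \<open>B t r p\<close> by simp
  then show "0 < c t"
    using pos[OF \<open>B t r p\<close>] by (metis zero_less_mult_pos2)
  have b0: "B t r0 p0"
    using \<open>B t r p\<close> center by (simp add: B')
  show dc: "(c has_real_derivative c' t) (at t)"
    unfolding c_def c'_def using Rt[OF b0] by (rule DERIV_cdivide)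
  have "eventually (\<lambda>s. s \<in> ?T) (nhds t)"
    using \<open>B t r p\<close> by (intro eventually_nhds_in_open) (auto simp: B')
  then have ev: "eventually (\<lambda>s. R s r p = c s * r) (nhds t)"
    by (rule eventually_mono) (use \<open>B t r p\<close> in \<open>auto simp: B' intro: R_lin\<close>)
  have "((\<lambda>s. c s * r) has_real_derivative c' t * r) (at t)"
    using dc by (rule DERIV_cmult_right)
  then have Rt_lin: "Rt t r p = c' t * r"
    using Rt[OF \<open>B t r p\<close>] DERIV_cong_ev[OF refl ev refl] DERIV_unique by blast
  have "r > 0"
    using pos[OF \<open>B t r p\<close>] by simp
  then have Rr_lin: "Rr t r p = c t"
    using R_rRr[OF \<open>B t r p\<close>] lin by simp
  then have "Pp t r p = 1 / c t"
    using jac[OF \<open>B t r p\<close>] \<open>0 < c t\<close> by (simp add: field_simps)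
  then have "P t r p * (1 / c t) * (c t * r) ^ 3 = r ^ 3 * (c' t * r + p * c t)"
    using R_eq[OF \<open>B t r p\<close>] by (simp add: lin Rt_lin Rr_lin)
  then have "P t r p * (c t)\<^sup>2 = c' t * r + p * c t"
    using \<open>r > 0\<close> \<open>0 < c t\<close> by (simp add: power_mult_distrib power2_eq_square power3_eq_cube)
  then show "P t r p = p / c t + r * c' t / (c t)\<^sup>2"
    using \<open>0 < c t\<close> by (simp add: field_simps power2_eq_square)
qed

section \<open>Rescaling the Newtonian potential\<close>

lemma lborel_integral_affine:
  fixes h :: "'a::euclidean_space \<Rightarrow> real"
  assumes [measurable]: "h \<in> borel_measurable borel" and "0 < a"
  shows "(LINT x|lborel. h (b + a *\<^sub>R x)) = (LINT x|lborel. h x) / a ^ DIM('a)"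
proof -
  have "(LINT x|lborel. h x)
      = (LINT x|Nonnegative_Lebesgue_Integration.density (distr lborel borel (\<lambda>x. b + a *\<^sub>R x)) (\<lambda>_. ennreal (\<bar>a\<bar> ^ DIM('a))). h x)"
    by (rule arg_cong[where f = "\<lambda>M. integral\<^sup>L M h", OF lborel_affine]) (use \<open>0 < a\<close> in simp)
  also have "\<dots> = a ^ DIM('a) * (LINT x|lborel. h (b + a *\<^sub>R x))"
    using \<open>0 < a\<close> by (simp add: integral_density integral_distr)
  finally show ?thesis
    using \<open>0 < a\<close> by simp
qed

text \<open>
  The substitution in \<open>v\<close> gives \<open>density G y = s\<^sup>3 * density Q (s *\<^sub>R y)\<close>, the one in \<open>y\<close> cancels \<open>s\<^sup>3\<close>, and the kernel leaves one
  factor \<open>s\<close>. The added shear \<open>g *\<^sub>R x\<close> is a translation in \<open>v\<close> and is invisible to the density.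
\<close>

lemma potential_rescale:
  assumes Q: "\<And>x. integrable lborel (Q x)" "\<And>x. integrable lborel (\<lambda>y. density Q y / norm (y - x))"
    and G: "\<And>x. integrable lborel (\<lambda>y. density G y / norm (y - x))"
    and "0 < s" and rescale: "\<And>x v. x \<noteq> 0 \<Longrightarrow> G x v = Q (s *\<^sub>R x) ((1 / s) *\<^sub>R v + g *\<^sub>R x)"
  shows "potential G x = s * potential Q (s *\<^sub>R x)"
proof -
  have density: "density G y = s ^ 3 * density Q (s *\<^sub>R y)" if "y \<noteq> 0" for y
  proof -
    have "Q (s *\<^sub>R y) \<in> borel_measurable borel"
      using borel_measurable_integrable[OF Q(1)] by simp
    from lborel_integral_affine[OF this, of "1 / s" "g *\<^sub>R y"] show ?thesis
      using \<open>0 < s\<close> by (simp add: density_def rescale[OF that] add.commute power_divide power3_eq_cube)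
  qed
  define k where "k y = density Q y / norm (y - s *\<^sub>R x)" for y
  have k [measurable]: "k \<in> borel_measurable borel"
    using borel_measurable_integrable[OF Q(2)] by (simp add: k_def[abs_def])
  have meas: "(\<lambda>y. density G y / norm (y - x)) \<in> borel_measurable lborel"
    using borel_measurable_integrable[OF G] .
  have "density G y / norm (y - x) = s ^ 4 * k (0 + s *\<^sub>R y)" if "y \<noteq> 0" for y
  proof -
    have "norm (s *\<^sub>R y - s *\<^sub>R x) = s * norm (y - x)"
      using \<open>0 < s\<close> by (metis abs_of_pos norm_scaleR scaleR_diff_right)
    then show ?thesis
      using \<open>0 < s\<close> by (simp add: density[OF that] k_def power_def numeral_eq_Suc)
  qed
  then have "AE y in lborel. density G y / norm (y - x) = s ^ 4 * k (0 + s *\<^sub>R y)"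
    using AE_lborel_singleton[of "0 :: real ^ 3"] by (auto elim: eventually_mono)
  then have "(LINT y|lborel. density G y / norm (y - x)) = (LINT y|lborel. s ^ 4 * k (0 + s *\<^sub>R y))"
    using meas by (intro integral_cong_AE) auto
  also have "\<dots> = s ^ 4 * ((LINT y|lborel. k y) / s ^ 3)"
    using lborel_integral_affine[OF k \<open>0 < s\<close>, of 0] by simp
  also have "\<dots> = s * (LINT y|lborel. k y)"
    using \<open>0 < s\<close> by (simp add: numeral_eq_Suc)
  finally show ?thesis
    by (simp add: potential_def k_def[abs_def])
qed

section \<open>The Vlasov equation in radial variables\<close>

text \<open>
  All radial computations take place in the plane spanned by \<open>e1\<close> and \<open>e2\<close>, which contains a
  representative of every triple \<open>(r, p, \<beta>)\<close>.
\<close>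

abbreviation e1 :: "real ^ 3" where "e1 \<equiv> axis 1 1"
abbreviation e2 :: "real ^ 3" where "e2 \<equiv> axis 2 1"

lemma inner_axis_plane [simp]: "e1 \<bullet> e1 = 1" "e1 \<bullet> e2 = 0" "e2 \<bullet> e1 = 0" "e2 \<bullet> e2 = 1"
  by (simp_all add: inner_axis_axis)

lemma inner_plane: "(a *\<^sub>R e1 + b *\<^sub>R e2) \<bullet> (c *\<^sub>R e1 + d *\<^sub>R e2) = a * c + b * d"
  by (simp add: inner_simps)

lemma norm_plane: "norm (a *\<^sub>R e1 + b *\<^sub>R e2) = sqrt (a\<^sup>2 + b\<^sup>2)"
  by (simp add: norm_eq_sqrt_inner inner_plane power2_eq_square)

lemma ang_mom_sq_plane:
  "ang_mom_sq (a *\<^sub>R e1 + b *\<^sub>R e2) (c *\<^sub>R e1 + d *\<^sub>R e2) = (a * d - b * c)\<^sup>2"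
  unfolding ang_mom_sq_def power2_norm_eq_inner inner_plane
  by (simp add: power2_eq_square algebra_simps)

text \<open>
  A point with radial coordinates \<open>(r, p, \<beta>)\<close> at polar angle \<open>\<theta>\<close>: the radial direction is
  \<open>(cos \<theta>, sin \<theta>)\<close>, and the tangential velocity is \<open>sqrt \<beta> / r\<close>.
\<close>

lemma radial_form_plane:
  assumes g: "radial_form g h" and "0 < r" "0 \<le> \<beta>"
  shows "g ((r * cos \<theta>) *\<^sub>R e1 + (r * sin \<theta>) *\<^sub>R e2)
      ((p * cos \<theta> - sqrt \<beta> / r * sin \<theta>) *\<^sub>R e1 + (p * sin \<theta> + sqrt \<beta> / r * cos \<theta>) *\<^sub>R e2) = h r p \<beta>"
    (is "g ?x ?v = _")
proof -
  have norm: "norm ?x = r"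
    using \<open>0 < r\<close> by (simp add: norm_plane power_mult_distrib distrib_left[symmetric] add.commute)
  then have "?x \<noteq> 0"
    using \<open>0 < r\<close> by force
  have "(r * c) * (p * c - q * s) + (r * s) * (p * s + q * c) = r * p * (s\<^sup>2 + c\<^sup>2)"
    "(r * c) * (p * s + q * c) - (r * s) * (p * c - q * s) = r * q * (s\<^sup>2 + c\<^sup>2)" for c s q
    by algebra+
  from this[where c = "cos \<theta>" and s = "sin \<theta>" and q = "sqrt \<beta> / r"]
  have "?x \<bullet> ?v = r * p" and ang: "ang_mom_sq ?x ?v = (r * (sqrt \<beta> / r))\<^sup>2"
    unfolding inner_plane ang_mom_sq_plane by (simp_all only: sin_cos_squared_add mult_1_right)
  then have inner: "?x \<bullet> ?v / norm ?x = p"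
    unfolding norm using \<open>0 < r\<close> by simp
  have "ang_mom_sq ?x ?v = \<beta>"
    unfolding ang using \<open>0 < r\<close> \<open>0 \<le> \<beta>\<close> by simp
  with g \<open>?x \<noteq> 0\<close> norm inner show ?thesis
    unfolding radial_form_def by simp
qed

lemmas radial_form_axis = radial_form_plane[where \<theta> = 0, simplified]

text \<open>
  The half turn about the axis \<open>e1\<close> preserves all inner products, hence \<open>r\<close>, \<open>p\<close> and \<open>\<beta>\<close>.
\<close>

lemma radial_form_axial_reflection:
  assumes g: "radial_form g h" and "x \<noteq> 0"
    and L: "\<And>x. L x = (2 * (x \<bullet> e1)) *\<^sub>R e1 - x"
  shows "g (L x) (L v) = g x v"
proof -
  have inner: "L x \<bullet> L y = x \<bullet> y" for x y
    by (simp add: L inner_simps inner_commute algebra_simps)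
  then have norm: "norm (L x) = norm x" for x
    by (simp add: norm_eq_sqrt_inner)
  then have "L x \<noteq> 0"
    using \<open>x \<noteq> 0\<close> by (metis norm_eq_zero)
  then show ?thesis
    using g \<open>x \<noteq> 0\<close> by (simp add: radial_form_def norm inner ang_mom_sq_def)
qed

lemma vlasov_poissonD:
  assumes "vlasov_poisson F" "F t x v \<noteq> 0"
  shows "(\<lambda>(s, y, w). F s y w) differentiable (at (t, x, v))"
    "\<exists>ft fx fv Ux. ((\<lambda>s. F s x v) has_real_derivative ft) (at t) \<and>
       (GDERIV (\<lambda>y. F t y v) x :> fx) \<and> (GDERIV (\<lambda>w. F t x w) v :> fv) \<and>
       (GDERIV (potential (F t)) x :> Ux) \<and> ft + v \<bullet> fx - Ux \<bullet> fv = 0"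
  using assms unfolding vlasov_poisson_def by simp_all

text \<open>
  The Vlasov equation in the variables \<open>(r, p, \<beta>)\<close>, stated along the radial characteristic because
  \<open>f\<close> need not be differentiable in \<open>\<beta>\<close>. Only the component \<open>Ux \<bullet> e1\<close> of the force matters: the
  half turn about \<open>e1\<close> fixes \<open>x\<close> and \<open>f\<close>, and averaging the equations at \<open>v\<close> and at the rotated \<open>v\<close>
  removes the other components.
\<close>

lemma radial_vlasov:
  assumes F: "vlasov_poisson F" "\<And>t. radial_form (F t) (f t)"
    and Ux: "GDERIV (potential (F t)) (r *\<^sub>R e1) :> Ux"
    and "0 < r" "0 \<le> \<beta>" "f t r p \<beta> \<noteq> 0"
  shows "((\<lambda>s. f (t + s) (r + p * s) (p + (\<beta> / r ^ 3 - Ux \<bullet> e1) * s) \<beta>) has_real_derivative 0) (at 0)"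
proof -
  define b where "b = sqrt \<beta>"
  define x where "x = r *\<^sub>R e1"
  define v where "v = p *\<^sub>R e1 + (b / r) *\<^sub>R e2"
  define m where "m = Ux \<bullet> e1"
  define L :: "real ^ 3 \<Rightarrow> real ^ 3" where "L x = (2 * (x \<bullet> e1)) *\<^sub>R e1 - x" for x
  let ?G = "\<lambda>(s, y, w). F s y w"
  have "x \<noteq> 0"
    using \<open>0 < r\<close> by (simp add: x_def)
  have blL: "bounded_linear L"
    unfolding L_def[abs_def] by (intro bounded_linear_intros)
  have LL: "L (L y) = y" for y
    by (simp add: L_def inner_simps)
  have Lx: "L x = x"
  proof -
    have "L x = (2 * r - r) *\<^sub>R e1"
      unfolding L_def x_def
      by (simp only: inner_scaleR_left inner_axis_plane mult_1_right scaleR_diff_left)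
    then show ?thesis
      by (simp add: x_def)
  qed
  have "F t x v = f t r p \<beta>"
    using radial_form_axis[OF F(2) \<open>0 < r\<close> \<open>0 \<le> \<beta>\<close>] by (simp add: x_def v_def b_def)
  then have nz: "F t x v \<noteq> 0"
    using assms by simp
  have reflect: "F s (L y) (L w) = F s y w" if "y \<noteq> 0" for s y w
    using radial_form_axial_reflection[OF F(2) that L_def] .
  have nzL: "F t x (L v) \<noteq> 0"
    using reflect[OF \<open>x \<noteq> 0\<close>, of t v] nz by (simp add: Lx)
  have equation: "\<exists>D. (?G has_derivative D) (at (t, x, w)) \<and> D (1, w, - Ux) = 0" if nzw: "F t x w \<noteq> 0" for w
  proof -
    obtain D where D: "(?G has_derivative D) (at (t, x, w))"
      using vlasov_poissonD(1)[OF F(1) nzw] unfolding differentiable_def by blast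
    obtain ft fx fv Ux' where d: "((\<lambda>s. F s x w) has_real_derivative ft) (at t)"
      "GDERIV (\<lambda>y. F t y w) x :> fx" "GDERIV (\<lambda>w. F t x w) w :> fv"
      "GDERIV (potential (F t)) x :> Ux'" "ft + w \<bullet> fx - Ux' \<bullet> fv = 0"
      using vlasov_poissonD(2)[OF F(1) nzw] by blast
    have "(\<lambda>h. h \<bullet> Ux') = (\<lambda>h. h \<bullet> Ux)"
      using d(4) Ux has_derivative_unique unfolding gderiv_def x_def by blast
    then have "Ux' = Ux"
      by (simp add: fun_eq_iff vector_eq_ldot)
    interpret D: bounded_linear D
      using D by (rule has_derivative_bounded_linear)
    have "((\<lambda>s. (s, x, w)) has_derivative (\<lambda>a. (a, 0, 0))) (at t)"
      by (auto intro!: derivative_eq_intros simp: zero_prod_def)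
    from has_derivative_compose[OF this D]
    have "((\<lambda>s. F s x w) has_derivative (\<lambda>a. D (a, 0, 0))) (at t)"
      by simp
    from fun_cong[OF has_derivative_unique[OF this d(1)[unfolded has_field_derivative_def]]]
    have ft: "D (1, 0, 0) = ft"
      by simp
    have "((\<lambda>y. (t, y, w)) has_derivative (\<lambda>a. (0, a, 0))) (at x)"
      by (auto intro!: derivative_eq_intros simp: zero_prod_def)
    from has_derivative_compose[OF this D]
    have "((\<lambda>y. F t y w) has_derivative (\<lambda>a. D (0, a, 0))) (at x)"
      by simp
    from fun_cong[OF has_derivative_unique[OF this d(2)[unfolded gderiv_def]]]
    have fx: "D (0, a, 0) = a \<bullet> fx" for a .
    have "((\<lambda>w. (t, x, w)) has_derivative (\<lambda>a. (0, 0, a))) (at w)"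
      by (auto intro!: derivative_eq_intros simp: zero_prod_def)
    from has_derivative_compose[OF this D]
    have "((\<lambda>w. F t x w) has_derivative (\<lambda>a. D (0, 0, a))) (at w)"
      by simp
    from fun_cong[OF has_derivative_unique[OF this d(3)[unfolded gderiv_def]]]
    have fv: "D (0, 0, a) = a \<bullet> fv" for a .
    have "(1 :: real, w, - Ux) = (1, 0, 0) + (0, w, 0) + (0, 0, - Ux)"
      by simp
    then have "D (1, w, - Ux) = D (1, 0, 0) + D (0, w, 0) + D (0, 0, - Ux)"
      by (simp only: D.add)
    then show ?thesis
      using D d(5) by (intro exI[of _ D]) (simp add: ft fx fv \<open>Ux' = Ux\<close>)
  qed
  obtain D where D: "(?G has_derivative D) (at (t, x, v))" "D (1, v, - Ux) = 0"
    using equation[OF nz] by blast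
  obtain D' where D': "(?G has_derivative D') (at (t, x, L v))" "D' (1, L v, - Ux) = 0"
    using equation[OF nzL] by blast
  interpret D: bounded_linear D
    using D(1) by (rule has_derivative_bounded_linear)
  \<comment> \<open>The half turn maps the derivative at \<open>v\<close> to the one at \<open>L v\<close>; the equation at \<open>L v\<close> thus becomes an
    equation for \<open>D\<close> with the force \<open>L Ux\<close>.\<close>
  have D_L: "D (a, y, w) = D' (a, L y, L w)" for a y w
  proof -
    have "((\<lambda>z. (fst z, L (fst (snd z)), L (snd (snd z)))) has_derivative
        (\<lambda>h. (fst h, L (fst (snd h)), L (snd (snd h))))) (at (t, x, v))"
      by (auto intro!: derivative_eq_intros bounded_linear.has_derivative[OF blL])
    from has_derivative_compose[OF this, of ?G D'] D'(1)
    have "((\<lambda>z. ?G (fst z, L (fst (snd z)), L (snd (snd z)))) has_derivative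
        (\<lambda>h. D' (fst h, L (fst (snd h)), L (snd (snd h))))) (at (t, x, v))"
      by (simp only: fst_conv snd_conv Lx)
    moreover have "open {z :: real \<times> (real ^ 3) \<times> (real ^ 3). fst (snd z) \<noteq> 0}"
      by (intro open_Collect_neq continuous_intros)
    ultimately have "(?G has_derivative (\<lambda>h. D' (fst h, L (fst (snd h)), L (snd (snd h))))) (at (t, x, v))"
      by (rule has_derivative_transform_within_open) (auto simp: reflect \<open>x \<noteq> 0\<close>)
    from fun_cong[OF has_derivative_unique[OF D(1) this], of "(a, y, w)"] show ?thesis
      by simp
  qed
  have "L (- L Ux) = - Ux"
    by (simp add: linear_neg[OF bounded_linear.linear[OF blL]] LL)
  then have "D (1, v, - L Ux) = 0"
    using D'(2) by (simp add: D_L)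
  have "(1 :: real, v, - (m *\<^sub>R e1)) = (1/2) *\<^sub>R ((1, v, - Ux) + (1, v, - L Ux))"
    by (simp add: L_def m_def scaleR_right_distrib[symmetric] scaleR_2[symmetric])
  then have key: "D (1, v, - (m *\<^sub>R e1)) = 0"
    using \<open>D (1, v, - L Ux) = 0\<close> D(2) by (simp only: D.add D.scaleR) simp
  \<comment> \<open>A curve with constant \<open>\<beta>\<close> through \<open>(t, x, v)\<close> with tangent \<open>(1, v, - m e1)\<close>. Its radial direction
    turns at the angular velocity \<open>\<omega>\<close> of the particle.\<close>
  define \<omega> where "\<omega> = b / r\<^sup>2"
  define rr where "rr s = r + p * s" for s
  define pp where "pp s = p + (\<beta> / r ^ 3 - m) * s" for s
  define c where "c s = (t + s,
      (rr s * cos (\<omega> * s)) *\<^sub>R e1 + (rr s * sin (\<omega> * s)) *\<^sub>R e2,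
      (pp s * cos (\<omega> * s) - b / rr s * sin (\<omega> * s)) *\<^sub>R e1
        + (pp s * sin (\<omega> * s) + b / rr s * cos (\<omega> * s)) *\<^sub>R e2)" for s
  have c0: "c 0 = (t, x, v)"
    by (simp add: c_def x_def v_def rr_def pp_def)
  have "b\<^sup>2 = \<beta>"
    using \<open>0 \<le> \<beta>\<close> by (simp add: b_def)
  have "(c has_derivative (\<lambda>a. a *\<^sub>R (1, v, - (m *\<^sub>R e1)))) (at 0)"
  proof -
    have 1: "((\<lambda>s. rr s * cos (\<omega> * s)) has_real_derivative p) (at 0)"
      unfolding rr_def by (auto intro!: derivative_eq_intros)
    have 2: "((\<lambda>s. rr s * sin (\<omega> * s)) has_real_derivative b / r) (at 0)"
      unfolding rr_def \<omega>_def using \<open>0 < r\<close>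
      by (auto intro!: derivative_eq_intros simp: power2_eq_square)
    have 3: "((\<lambda>s. pp s * cos (\<omega> * s) - b / rr s * sin (\<omega> * s)) has_real_derivative - m) (at 0)"
      unfolding rr_def pp_def \<omega>_def using \<open>0 < r\<close> \<open>b\<^sup>2 = \<beta>\<close>
      by (auto intro!: derivative_eq_intros simp: field_simps power2_eq_square power3_eq_cube)
    have 4: "((\<lambda>s. pp s * sin (\<omega> * s) + b / rr s * cos (\<omega> * s)) has_real_derivative 0) (at 0)"
      unfolding rr_def pp_def \<omega>_def using \<open>0 < r\<close>
      by (auto intro!: derivative_eq_intros simp: field_simps power2_eq_square)
    have "((\<lambda>s. (t + s,
      (rr s * cos (\<omega> * s)) *\<^sub>R e1 + (rr s * sin (\<omega> * s)) *\<^sub>R e2,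
      (pp s * cos (\<omega> * s) - b / rr s * sin (\<omega> * s)) *\<^sub>R e1
        + (pp s * sin (\<omega> * s) + b / rr s * cos (\<omega> * s)) *\<^sub>R e2)) has_derivative
      (\<lambda>a. (a, (p * a) *\<^sub>R e1 + (b / r * a) *\<^sub>R e2, (- m * a) *\<^sub>R e1 + (0 * a) *\<^sub>R e2))) (at 0)"
      by (intro has_derivative_Pair has_derivative_add has_derivative_scaleR_left
          1[unfolded has_field_derivative_def] 2[unfolded has_field_derivative_def]
          3[unfolded has_field_derivative_def] 4[unfolded has_field_derivative_def])
        (auto intro!: derivative_eq_intros)
    then show ?thesis
      by (simp add: c_def[abs_def] v_def scaleR_add_right mult.commute)
  qed
  from has_derivative_compose[OF this, of ?G D]
  have "((\<lambda>s. ?G (c s)) has_derivative (\<lambda>a. D (a *\<^sub>R (1, v, - (m *\<^sub>R e1))))) (at 0)"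
    using D(1) by (simp add: c0)
  then have deriv0: "((\<lambda>s. ?G (c s)) has_real_derivative 0) (at 0)"
    by (rule has_derivative_imp_has_field_derivative) (simp only: D.scaleR key, simp)
  have "eventually (\<lambda>s. 0 < rr s) (nhds 0)"
  proof -
    have "isCont rr 0"
      unfolding rr_def by (intro continuous_intros)
    then have "(rr \<longlongrightarrow> r) (nhds 0)"
      by (simp add: rr_def continuous_at tendsto_nhds_iff)
    then show ?thesis
      using \<open>0 < r\<close> by (rule order_tendstoD)
  qed
  then have ev: "eventually (\<lambda>s. ?G (c s) = f (t + s) (rr s) (pp s) \<beta>) (nhds 0)"
    by (rule eventually_mono)
      (unfold c_def b_def prod.case, rule radial_form_plane[OF F(2) _ \<open>0 \<le> \<beta>\<close>])
  have "((\<lambda>s. f (t + s) (rr s) (pp s) \<beta>) has_real_derivative 0) (at 0)"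
    using deriv0 DERIV_cong_ev[OF refl ev refl] by simp
  then show ?thesis
    by (simp add: rr_def pp_def m_def)
qed

section \<open>The support in radial variables\<close>

text \<open>
  A set of codimension at least two does not disconnect. If \<open>V\<close> and \<open>W\<close> separated the remainder, each of
  them could be completed by the points of the axis that it surrounds: a small ball around a point
  of the axis, with the axis removed, is connected and so lies in \<open>V\<close> or in \<open>W\<close>. Then \<open>A\<close> itself would
  be separated.
\<close>

lemma connected_Diff_axis:
  fixes A :: "('a::euclidean_space \<times> 'b::euclidean_space) set"
  assumes "2 \<le> DIM('a)" "open A" "connected A"
  shows "connected (A - {0} \<times> UNIV)"
proof (rule connectedI)
  let ?Z = "{0} \<times> UNIV :: ('a \<times> 'b) set"
  have "closed ?Z"
    by (intro closed_Times) auto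
  fix V W
  assume V: "open V" "V \<inter> (A - ?Z) \<noteq> {}" and W: "open W" "W \<inter> (A - ?Z) \<noteq> {}"
    and disj: "V \<inter> W \<inter> (A - ?Z) = {}" and cover: "A - ?Z \<subseteq> V \<union> W"
  have "interior ?Z = {}"
    by (simp add: interior_Times)
  have hits: "G \<inter> (A - ?Z) \<subseteq> interior (G \<inter> A \<union> ?Z)" if "open G" for G
    using \<open>open A\<close> \<open>closed ?Z\<close> that by (intro interior_maximal) auto
  have "interior (V \<inter> A \<union> ?Z) \<inter> interior (W \<inter> A \<union> ?Z) \<subseteq> interior ?Z"
    using disj by (subst interior_Int[symmetric], intro interior_mono) blast
  \<comment> \<open>The two completed sets meet at most in the axis, which has no interior point.\<close>
  then have disjoint: "interior (V \<inter> A \<union> ?Z) \<inter> interior (W \<inter> A \<union> ?Z) = {}"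
    using \<open>interior ?Z = {}\<close> by blast
  have "z \<in> interior (V \<inter> A \<union> ?Z) \<union> interior (W \<inter> A \<union> ?Z)" if "z \<in> A" for z
  proof (cases "z \<in> ?Z")
    case False
    then show ?thesis
      using cover hits V(1) W(1) that by blast
  next
    case True
    then obtain v where z: "z = (0, v)"
      by auto
    obtain X Y where XY: "open X" "open Y" "z \<in> X \<times> Y" "X \<times> Y \<subseteq> A"
      using open_prod_elim[OF \<open>open A\<close> \<open>z \<in> A\<close>] by blast
    then obtain e where "e > 0" "ball (0::'a) e \<subseteq> X"
      unfolding z using open_contains_ball by blast
    obtain d where "d > 0" "ball v d \<subseteq> Y"
      using XY unfolding z using open_contains_ball by blast
    let ?N = "(ball (0::'a) e - {0}) \<times> ball v d"
    have "connected ?N"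
      by (intro connected_Times connected_punctured_ball \<open>2 \<le> DIM('a)\<close> connected_ball)
    moreover have "?N \<subseteq> A - ?Z"
      using XY(4) \<open>ball 0 e \<subseteq> X\<close> \<open>ball v d \<subseteq> Y\<close> by blast
    ultimately have "V \<inter> ?N = {} \<or> W \<inter> ?N = {}"
      using connectedD[of ?N V W] V(1) W(1) disj cover by blast
    then have "?N \<subseteq> W \<or> ?N \<subseteq> V"
      using \<open>?N \<subseteq> A - ?Z\<close> cover by blast
    then have "ball (0::'a) e \<times> ball v d \<subseteq> V \<inter> A \<union> ?Z \<or> ball 0 e \<times> ball v d \<subseteq> W \<inter> A \<union> ?Z"
      using XY(4) \<open>ball 0 e \<subseteq> X\<close> \<open>ball v d \<subseteq> Y\<close> by blast
    moreover have "open (ball (0::'a) e \<times> ball v d)" "z \<in> ball (0::'a) e \<times> ball v d"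
      using \<open>e > 0\<close> \<open>d > 0\<close> by (auto simp: z intro: open_Times)
    ultimately show ?thesis
      by (meson UnI1 UnI2 interiorI)
  qed
  then have "A \<subseteq> interior (V \<inter> A \<union> ?Z) \<union> interior (W \<inter> A \<union> ?Z)"
    by blast
  moreover have "interior (V \<inter> A \<union> ?Z) \<inter> A \<noteq> {}" "interior (W \<inter> A \<union> ?Z) \<inter> A \<noteq> {}"
    using V W hits by blast+
  ultimately show False
    using connectedD[OF \<open>connected A\<close> open_interior open_interior] disjoint by blast
qed

text \<open>
  The part \<open>r > 0\<close> of \<open>radial_support\<close> before taking the closure. It inherits openness and connectedness from
  the set in phase space where the distribution does not vanish.
\<close>

definition radial_base :: "(real \<Rightarrow> real \<Rightarrow> real \<Rightarrow> real) \<Rightarrow> (real \<times> real) set" where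
  "radial_base h = {(r, p). 0 < r \<and> (\<exists>\<beta>\<ge>0. h r p \<beta> \<noteq> 0)}"

lemma radial_support_eq: "radial_support h = closure (radial_base h)"
  by (simp add: radial_support_def radial_base_def)

lemma ang_mom_sq_nonneg: "0 \<le> ang_mom_sq x v"
  using Cauchy_Schwarz_ineq[of x v] by (simp add: ang_mom_sq_def power2_norm_eq_inner)

lemma radial_base_memI:
  assumes "radial_form g h" "g x v \<noteq> 0" "x \<noteq> 0"
  shows "(norm x, x \<bullet> v / norm x) \<in> radial_base h"
  using assms ang_mom_sq_nonneg[of x v] unfolding radial_form_def radial_base_def by force

text \<open>
  Topological properties of the support in phase space pass to \<open>radial_base\<close> through this image
  (connectedness) and through the section \<open>(r, p) \<mapsto> (r e1, p e1 + (sqrt \<beta> / r) e2)\<close> (openness).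
\<close>

lemma radial_base_eq_image:
  assumes "radial_form g h"
  shows "radial_base h = (\<lambda>(x, v). (norm x, x \<bullet> v / norm x)) ` ({(x, v). g x v \<noteq> 0} - {0} \<times> UNIV)"
    (is "_ = ?w ` ?A")
proof
  show "?w ` ?A \<subseteq> radial_base h"
    using radial_base_memI[OF assms] by auto
  show "radial_base h \<subseteq> ?w ` ?A"
  proof
    fix z
    assume "z \<in> radial_base h"
    then obtain r p \<beta> where z: "z = (r, p)" "0 < r" "0 \<le> \<beta>" "h r p \<beta> \<noteq> 0"
      by (auto simp: radial_base_def)
    have "(r *\<^sub>R e1, p *\<^sub>R e1 + (sqrt \<beta> / r) *\<^sub>R e2) \<in> ?A"
      using radial_form_axis[OF assms z(2,3), of p] z by auto
    moreover have "?w (r *\<^sub>R e1, p *\<^sub>R e1 + (sqrt \<beta> / r) *\<^sub>R e2) = z"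
      using z by (simp add: inner_simps)
    ultimately show "z \<in> ?w ` ?A"
      by force
  qed
qed

lemma connected_radial_base:
  assumes "radial_form g h" "open {(x, v). g x v \<noteq> 0}" "connected {(x, v). g x v \<noteq> 0}"
  shows "connected (radial_base h)"
  unfolding radial_base_eq_image[OF assms(1)] using assms(2,3)
  by (intro connected_continuous_image connected_Diff_axis)
    (auto simp: split_def intro!: continuous_intros)

lemma open_radial_base:
  assumes "radial_form g h" "open {(x, v). g x v \<noteq> 0}"
  shows "open (radial_base h)"
proof -
  let ?T = "{0<..} \<times> UNIV :: (real \<times> real) set"
  let ?\<psi> = "\<lambda>\<beta> (r, p). (r *\<^sub>R e1, p *\<^sub>R e1 + (sqrt \<beta> / r) *\<^sub>R e2)"
  have "radial_base h = (\<Union>\<beta>\<in>{0..}. ?T \<inter> ?\<psi> \<beta> -` {(x, v). g x v \<noteq> 0})"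
    using radial_form_axis[OF assms(1)] by (auto simp: radial_base_def)
  also have "open \<dots>"
    using assms(2)
    by (intro open_UN ballI continuous_open_preimage) (auto simp: split_def intro!: continuous_intros open_Times)
  finally show ?thesis .
qed

text \<open>
  If a particle may sit at the centre with velocity \<open>v\<close>, then \<open>radial_base\<close> contains a half neighbourhood
  around the boundary point \<open>(0, v \<bullet> e1)\<close>: approach the centre along \<open>e1\<close>.
\<close>

lemma radial_base_near_center:
  assumes "radial_form g h" "open {(x, v). g x v \<noteq> 0}" "g 0 v \<noteq> 0"
  obtains \<epsilon> where "\<epsilon> > 0" "\<And>r p. \<lbrakk>0 < r; r < \<epsilon>; \<bar>p - v \<bullet> e1\<bar> < \<epsilon>\<rbrakk> \<Longrightarrow> (r, p) \<in> radial_base h"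
proof -
  let ?\<psi> = "\<lambda>(r, p). (r *\<^sub>R e1, v + (p - v \<bullet> e1) *\<^sub>R e1)"
  have op: "open (?\<psi> -` {(x, v). g x v \<noteq> 0})"
    using assms(2) by (rule open_vimage) (auto simp: split_def intro!: continuous_intros)
  have "(0, v \<bullet> e1) \<in> ?\<psi> -` {(x, v). g x v \<noteq> 0}"
    using assms(3) by simp
  then obtain X Y where XY: "open X" "open Y" "(0, v \<bullet> e1) \<in> X \<times> Y" "X \<times> Y \<subseteq> ?\<psi> -` {(x, v). g x v \<noteq> 0}"
    using open_prod_elim[OF op] by blast
  then obtain e d where "e > 0" "d > 0" and e: "ball 0 e \<subseteq> X" and d: "ball (v \<bullet> e1) d \<subseteq> Y"
    using open_contains_ball by (metis mem_Sigma_iff)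
  show thesis
  proof
    show "min e d > 0"
      using \<open>e > 0\<close> \<open>d > 0\<close> by simp
    fix r p :: real
    assume rp: "0 < r" "r < min e d" "\<bar>p - v \<bullet> e1\<bar> < min e d"
    have "r \<in> X" "p \<in> Y"
      using rp by (intro subsetD[OF e] subsetD[OF d]; simp add: dist_real_def abs_minus_commute)+
    then have "g (r *\<^sub>R e1) (v + (p - v \<bullet> e1) *\<^sub>R e1) \<noteq> 0"
      using XY(4) by auto
    moreover have "(r * (v \<bullet> e1) + (p - v \<bullet> e1) * r) / r = p"
      using \<open>0 < r\<close> by (simp add: field_simps)
    ultimately show "(r, p) \<in> radial_base h"
      using radial_base_memI[OF assms(1), of "r *\<^sub>R e1" "v + (p - v \<bullet> e1) *\<^sub>R e1"] \<open>0 < r\<close>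
      by (simp add: inner_simps inner_commute)
  qed
qed

section \<open>Energy-preserving substitutions of a steady state\<close>

text \<open>
  The factor \<open>U' - \<beta> / r\<^sup>3\<close> is minus the effective radial force on a particle of the steady state.
\<close>

lemma radial_energy_has_derivative:
  assumes X: "(X has_real_derivative X') (at s)" and Y: "(Y has_real_derivative Y') (at s)"
    and U: "(U has_real_derivative U') (at (X s))" and "X s \<noteq> 0"
  shows "((\<lambda>s. radial_energy U (X s) (Y s) \<beta>) has_real_derivative
    Y s * Y' + (U' - \<beta> / X s ^ 3) * X') (at s)"
proof -
  have "((\<lambda>s. (Y s)\<^sup>2 / 2) has_real_derivative Y s * Y') (at s)"
    by (auto intro!: derivative_eq_intros Y)
  moreover have "((\<lambda>s. U (X s)) has_real_derivative U' * X') (at s)"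
    using DERIV_chain2[OF U X] .
  moreover have "((\<lambda>s. \<beta> / (2 * (X s)\<^sup>2)) has_real_derivative - (\<beta> / X s ^ 3) * X') (at s)"
    using \<open>X s \<noteq> 0\<close>
    by (auto intro!: derivative_eq_intros X simp: field_simps power2_eq_square power3_eq_cube)
  ultimately have "((\<lambda>s. (Y s)\<^sup>2 / 2 + U (X s) + \<beta> / (2 * (X s)\<^sup>2)) has_real_derivative
      Y s * Y' + U' * X' + - (\<beta> / X s ^ 3) * X') (at s)"
    by (intro DERIV_add)
  then show ?thesis
    unfolding radial_energy_def by (simp add: algebra_simps)
qed

text \<open>
  The map \<open>(x, v) \<mapsto> (s x, v / s + g x)\<close> preserves \<open>x \<wedge> v\<close>.
\<close>

lemma ang_mom_sq_rescale:
  assumes "s \<noteq> 0"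
  shows "ang_mom_sq (s *\<^sub>R x) ((1 / s) *\<^sub>R v + g *\<^sub>R x) = ang_mom_sq x v"
proof -
  have "(s\<^sup>2 * a) * (b / s\<^sup>2 + 2 * (g / s * c) + g\<^sup>2 * a) - (c + s * g * a)\<^sup>2 = a * b - c\<^sup>2" for a b c :: real
    using assms by (simp add: field_simps power2_eq_square)
  from this[of "x \<bullet> x" "v \<bullet> v" "x \<bullet> v"] show ?thesis
    using assms unfolding ang_mom_sq_def power2_norm_eq_inner
    by (simp add: inner_simps inner_commute algebra_simps power2_eq_square)
qed

lemma vlasov_poisson_integrable:
  assumes "vlasov_poisson F"
  shows "integrable lborel (F t x)" "integrable lborel (\<lambda>y. density (F t) y / norm (y - x))"
  using assms unfolding vlasov_poisson_def by simp_all

text \<open>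
  The hypotheses of the theorem with the regularity of \<open>R\<close> and \<open>P\<close> expressed by their partial
  derivatives. Liouville's theorem stands in for the Hamiltonian (\<open>jacobian\<close>), and positivity of \<open>R\<close> for
  the monotonicity in \<open>r\<close>.
\<close>

locale energy_substitution =
  fixes Qt :: "real \<Rightarrow> real \<Rightarrow> real"
    and Q :: phase_fun
    and U U' :: "real \<Rightarrow> real"
    and \<alpha> :: real
    and R P :: "real \<Rightarrow> real \<Rightarrow> real \<Rightarrow> real"
    and F :: "real \<Rightarrow> phase_fun"
    and f :: "real \<Rightarrow> real \<Rightarrow> real \<Rightarrow> real \<Rightarrow> real"
    and Rt Rr Rp Rtt Pt Pr Pp :: "real \<Rightarrow> real \<Rightarrow> real \<Rightarrow> real"
    and \<sigma> :: "real \<Rightarrow> real"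
  assumes steady: "vlasov_poisson (\<lambda>t. Q)"
    and Q: "\<And>x v. Q x v = Qt (energy U x v) (ang_mom_sq x v)"
    and U: "\<And>x. potential Q x = U (norm x)"
    and U': "\<And>r. 0 \<le> r \<Longrightarrow> (U has_real_derivative U' r) (at r within {0..})"
    and U'': "(U' has_real_derivative \<alpha>) (at 0 within {0..})"
    and U'_0: "U' 0 = 0"
    and connected_support: "connected {(x, v). Q x v \<noteq> 0}"
    and center_in_support: "\<exists>v. Q 0 v \<noteq> 0"
    and solution: "vlasov_poisson F"
    and F: "\<And>t. radial_form (F t) (f t)"
    and f: "\<And>t r p \<beta>. \<lbrakk>0 < r; 0 \<le> \<beta>\<rbrakk> \<Longrightarrow> f t r p \<beta> = Qt (radial_energy U (R t r p) (P t r p) \<beta>) \<beta>"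
    and dR_within: "\<And>t r p. 0 \<le> r \<Longrightarrow> ((\<lambda>(t, r, p). R t r p) has_derivative
       (\<lambda>(a, b, c). a * Rt t r p + b * Rr t r p + c * Rp t r p)) (at (t, r, p) within {(t, r, p). 0 \<le> r})"
    and dP_within: "\<And>t r p. 0 \<le> r \<Longrightarrow> ((\<lambda>(t, r, p). P t r p) has_derivative
       (\<lambda>(a, b, c). a * Pt t r p + b * Pr t r p + c * Pp t r p)) (at (t, r, p) within {(t, r, p). 0 \<le> r})"
    and continuous_partials: "continuous_on {(t, r, p). 0 \<le> r} (\<lambda>(t, r, p). Rr t r p)"
      "continuous_on {(t, r, p). 0 \<le> r} (\<lambda>(t, r, p). Rp t r p)"
      "continuous_on {(t, r, p). 0 \<le> r} (\<lambda>(t, r, p). Pr t r p)"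
      "continuous_on {(t, r, p). 0 \<le> r} (\<lambda>(t, r, p). Pp t r p)"
    and Rtt: "\<And>t r p. 0 < r \<Longrightarrow> ((\<lambda>s. Rt s r p) has_real_derivative Rtt t r p) (at t)"
    and jacobian: "\<And>t r p. 0 < r \<Longrightarrow> Rr t r p * Pp t r p - Rp t r p * Pr t r p = 1"
    and R_pos: "\<And>t r p. 0 < r \<Longrightarrow> 0 < R t r p"
    and R_over_r: "\<And>t p. ((\<lambda>\<delta>. R t \<delta> p / \<delta>) \<longlongrightarrow> \<sigma> t) (at_right 0)"
    and Qt_deriv: "\<And>x v. Q x v \<noteq> 0 \<Longrightarrow>
          \<exists>d. d \<noteq> 0 \<and> ((\<lambda>e. Qt e (ang_mom_sq x v)) has_real_derivative d) (at (energy U x v))"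
begin

abbreviation profile where "profile r p \<beta> \<equiv> Qt (radial_energy U r p \<beta>) \<beta>"

lemma energy_eq_radial_energy:
  assumes "x \<noteq> 0"
  shows "energy U x v = radial_energy U (norm x) (x \<bullet> v / norm x) (ang_mom_sq x v)"
  using assms by (simp add: energy_def radial_energy_def ang_mom_sq_def field_simps power2_eq_square)

lemma radial_form_Q: "radial_form Q profile"
  unfolding radial_form_def by (simp add: Q energy_eq_radial_energy)

text \<open>
  \<open>vlasov_poisson\<close> speaks of an open set in space-time; for a steady state take a time slice.
\<close>

lemma open_Q: "open {(x, v). Q x v \<noteq> 0}"
proof -
  have "open {(t :: real, x, v). Q x v \<noteq> 0}"
    using steady by (simp add: vlasov_poisson_def)
  then have "open ((\<lambda>z. (0 :: real, z)) -` {(t, x, v). Q x v \<noteq> 0})"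
    by (rule open_vimage) (intro continuous_intros)
  then show ?thesis
    by (simp add: vimage_def split_def)
qed

lemma open_base: "open (radial_base profile)"
  using open_radial_base[OF radial_form_Q open_Q] .

lemma connected_base: "connected (radial_base profile)"
  using connected_radial_base[OF radial_form_Q open_Q connected_support] .

lemma base_iff: "(r, p) \<in> radial_base (f t) \<longleftrightarrow> 0 < r \<and> (R t r p, P t r p) \<in> radial_base profile"
  using f R_pos by (auto simp: radial_base_def)

lemma dR: "((\<lambda>(t, r, p). R t r p) has_derivative
       (\<lambda>(a, b, c). a * Rt t r p + b * Rr t r p + c * Rp t r p)) (at (t, r, p))"
  and dP: "((\<lambda>(t, r, p). P t r p) has_derivative
       (\<lambda>(a, b, c). a * Pt t r p + b * Pr t r p + c * Pp t r p)) (at (t, r, p))" if "0 < r"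
  using that by (intro has_derivative_at_interior_half_space dR_within dP_within; simp)+

lemmas partials_R = partials_of_derivative[OF dR]
lemmas partials_P = partials_of_derivative[OF dP]

lemma continuous_R: "continuous_on {(t, r, p). 0 \<le> r} (\<lambda>(t, r, p). R t r p)"
  and continuous_P: "continuous_on {(t, r, p). 0 \<le> r} (\<lambda>(t, r, p). P t r p)"
  unfolding continuous_on_eq_continuous_within
  using has_derivative_continuous[OF dR_within] has_derivative_continuous[OF dP_within] by auto

lemma continuous_Z: "continuous_on {(t, r, p). 0 \<le> r} (\<lambda>(t, r, p). (R t r p, P t r p))"
  using continuous_R continuous_P by (auto simp: split_def intro!: continuous_intros)

lemma continuous_Z_comp:
  assumes "continuous_on S a" "continuous_on S b" "continuous_on S c" "\<And>z. z \<in> S \<Longrightarrow> 0 \<le> b z"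
  shows "continuous_on S (\<lambda>z. (R (a z) (b z) (c z), P (a z) (b z) (c z)))"
proof -
  have "continuous_on S (\<lambda>z. (\<lambda>(t, r, p). (R t r p, P t r p)) (a z, b z, c z))"
    using assms by (intro continuous_on_compose2[OF continuous_Z]) (auto intro!: continuous_intros)
  then show ?thesis
    by simp
qed

lemma U'_at: "0 < r \<Longrightarrow> (U has_real_derivative U' r) (at r)"
  using U'[of r] at_within_open_subset[of r "{0<..}" "{0..}"] by (simp add: subset_eq)

text \<open>
  Since \<open>\<partial>\<^sub>e Qt \<noteq> 0\<close> on the support, constancy of \<open>f\<close> along a radial characteristic forces the
  energy of \<open>(R, P, \<beta>)\<close> to be stationary along it. The derivative of \<open>Qt\<close> is taken at the
  phase space point \<open>(R e1, P e1 + (sqrt \<beta> / R) e2)\<close>.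
\<close>

lemma energy_conserved:
  assumes "0 < r" "0 \<le> \<beta>" "f t r p \<beta> \<noteq> 0" "GDERIV (potential (F t)) (r *\<^sub>R e1) :> Ux"
  defines "k \<equiv> \<beta> / r ^ 3 - Ux \<bullet> e1"
  shows "P t r p * (Pt t r p + p * Pr t r p + k * Pp t r p)
    + (U' (R t r p) - \<beta> / R t r p ^ 3) * (Rt t r p + p * Rr t r p + k * Rp t r p) = 0"
proof -
  let ?R = "R t r p" and ?P = "P t r p"
  let ?line = "\<lambda>s. (t + s, r + p * s, p + k * s)"
  have dline: "(?line has_derivative (\<lambda>a. (a, p * a, k * a))) (at 0)"
    by (auto intro!: derivative_eq_intros)
  have "((\<lambda>s. (\<lambda>(t, r, p). R t r p) (?line s)) has_derivative
      (\<lambda>a. (\<lambda>(a, b, c). a * Rt t r p + b * Rr t r p + c * Rp t r p) (a, p * a, k * a))) (at 0)"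
    using dR[OF \<open>0 < r\<close>] by (intro has_derivative_compose[OF dline]) simp
  then have dR': "((\<lambda>s. R (t + s) (r + p * s) (p + k * s)) has_real_derivative
      Rt t r p + p * Rr t r p + k * Rp t r p) (at 0)"
    unfolding prod.case by (rule has_derivative_imp_has_field_derivative) (simp add: algebra_simps)
  have "((\<lambda>s. (\<lambda>(t, r, p). P t r p) (?line s)) has_derivative
      (\<lambda>a. (\<lambda>(a, b, c). a * Pt t r p + b * Pr t r p + c * Pp t r p) (a, p * a, k * a))) (at 0)"
    using dP[OF \<open>0 < r\<close>] by (intro has_derivative_compose[OF dline]) simp
  then have dP': "((\<lambda>s. P (t + s) (r + p * s) (p + k * s)) has_real_derivative
      Pt t r p + p * Pr t r p + k * Pp t r p) (at 0)"
    unfolding prod.case by (rule has_derivative_imp_has_field_derivative) (simp add: algebra_simps)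
  let ?E = "\<lambda>s. radial_energy U (R (t + s) (r + p * s) (p + k * s)) (P (t + s) (r + p * s) (p + k * s)) \<beta>"
  let ?e = "?P * (Pt t r p + p * Pr t r p + k * Pp t r p)
    + (U' ?R - \<beta> / ?R ^ 3) * (Rt t r p + p * Rr t r p + k * Rp t r p)"
  have "0 < ?R"
    using R_pos[OF \<open>0 < r\<close>] .
  have dE: "(?E has_real_derivative ?e) (at 0)"
    using radial_energy_has_derivative[OF dR' dP', of U "U' ?R" \<beta>] U'_at[OF \<open>0 < ?R\<close>] \<open>0 < ?R\<close>
    by simp
  let ?x = "?R *\<^sub>R e1" and ?v = "?P *\<^sub>R e1 + (sqrt \<beta> / ?R) *\<^sub>R e2"
  have Q0: "Q ?x ?v = profile ?R ?P \<beta>"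
    using radial_form_axis[OF radial_form_Q \<open>0 < ?R\<close> \<open>0 \<le> \<beta>\<close>] .
  then have "Q ?x ?v \<noteq> 0"
    using f[OF \<open>0 < r\<close> \<open>0 \<le> \<beta>\<close>] assms(3) by simp
  moreover have ang: "ang_mom_sq ?x ?v = \<beta>"
    using ang_mom_sq_plane[of ?R 0 ?P "sqrt \<beta> / ?R"] \<open>0 < ?R\<close> \<open>0 \<le> \<beta>\<close> by simp
  moreover have "energy U ?x ?v = ?E 0"
    using energy_eq_radial_energy[of ?x ?v] \<open>0 < ?R\<close> by (simp add: ang inner_simps)
  ultimately obtain d where "d \<noteq> 0" and "((\<lambda>e. Qt e \<beta>) has_real_derivative d) (at (?E 0))"
    using Qt_deriv by metis
  then have dQ: "((\<lambda>s. Qt (?E s) \<beta>) has_real_derivative d * ?e) (at 0)"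
    using DERIV_chain2[OF _ dE] by simp
  have "((\<lambda>s. r + p * s) \<longlongrightarrow> r + p * 0) (nhds 0)"
    by (intro tendsto_intros filterlim_ident)
  then have "eventually (\<lambda>s. 0 < r + p * s) (nhds 0)"
    using \<open>0 < r\<close> by (intro order_tendstoD(1)) auto
  then have ev: "eventually (\<lambda>s. f (t + s) (r + p * s) (p + k * s) \<beta> = Qt (?E s) \<beta>) (nhds 0)"
    by (rule eventually_mono) (rule f[OF _ \<open>0 \<le> \<beta>\<close>])
  have "((\<lambda>s. f (t + s) (r + p * s) (p + k * s) \<beta>) has_real_derivative 0) (at 0)"
    using radial_vlasov[OF solution F assms(4,1,2,3)] by (simp add: k_def)
  then have "((\<lambda>s. Qt (?E s) \<beta>) has_real_derivative 0) (at 0)"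
    using DERIV_cong_ev[OF refl ev refl] by simp
  then have "d * ?e = 0"
    using dQ DERIV_unique by blast
  then show ?thesis
    using \<open>d \<noteq> 0\<close> by simp
qed

text \<open>
  Changing the tangential velocity changes \<open>\<beta>\<close> alone. Only larger values of \<open>\<beta>\<close> are considered, so that
  the case \<open>\<beta>0 = 0\<close> is included.
\<close>

lemma open_angular_momenta:
  assumes "0 < r" "0 \<le> \<beta>0" "f t r p \<beta>0 \<noteq> 0"
  obtains \<eta> where "\<eta> > 0" "\<And>\<beta>. \<lbrakk>\<beta>0 \<le> \<beta>; \<beta> \<le> \<beta>0 + \<eta>\<rbrakk> \<Longrightarrow> f t r p \<beta> \<noteq> 0"
proof -
  let ?R = "R t r p"
  let ?\<psi> = "\<lambda>\<beta>. (?R *\<^sub>R e1, P t r p *\<^sub>R e1 + (sqrt \<beta> / ?R) *\<^sub>R e2)"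
  have eq: "(case ?\<psi> \<beta> of (x, v) \<Rightarrow> Q x v) = f t r p \<beta>" if "0 \<le> \<beta>" for \<beta>
    using radial_form_axis[OF radial_form_Q R_pos[OF \<open>0 < r\<close>] that] f[OF \<open>0 < r\<close> that] by simp
  have "?R \<noteq> 0"
    using R_pos[OF \<open>0 < r\<close>, where t = t and p = p] by simp
  have "open (?\<psi> -` {(x, v). Q x v \<noteq> 0})"
    using open_Q \<open>?R \<noteq> 0\<close> by (intro open_vimage) (auto intro!: continuous_intros)
  moreover have "\<beta>0 \<in> ?\<psi> -` {(x, v). Q x v \<noteq> 0}"
    using eq[OF \<open>0 \<le> \<beta>0\<close>] assms(3) by simp
  ultimately obtain e where "e > 0" "ball \<beta>0 e \<subseteq> ?\<psi> -` {(x, v). Q x v \<noteq> 0}"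
    using open_contains_ball by blast
  then have e: "f t r p \<beta> \<noteq> 0" if "\<beta>0 \<le> \<beta>" "\<beta> < \<beta>0 + e" for \<beta>
  proof -
    have "\<beta> \<in> ball \<beta>0 e"
      using that by (simp add: dist_real_def)
    then have "\<beta> \<in> ?\<psi> -` {(x, v). Q x v \<noteq> 0}"
      using \<open>ball \<beta>0 e \<subseteq> _\<close> by blast
    then show ?thesis
      using eq[of \<beta>] that \<open>0 \<le> \<beta>0\<close> by simp
  qed
  show thesis
    by (rule that[of "e / 2"]) (use e \<open>e > 0\<close> in auto)
qed

text \<open>
  The energy equation at fixed \<open>(t, r, p)\<close> is a quadratic polynomial in \<open>\<beta>\<close>: \<open>\<beta>\<close> enters through the
  centrifugal terms of both the actual and the substituted motion. Its coefficients vanish because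
  it has at least three zeros. The third claim is the one that sees the gravitational field.
\<close>

lemma transport_equations:
  assumes "(r, p) \<in> radial_base (f t)"
  shows "Rp t r p = 0"
    "P t r p * Pp t r p * R t r p ^ 3 = r ^ 3 * (Rt t r p + p * Rr t r p)"
    "GDERIV (potential (F t)) (r *\<^sub>R e1) :> Ux \<Longrightarrow>
      P t r p * (Pt t r p + p * Pr t r p - (Ux \<bullet> e1) * Pp t r p)
      + U' (R t r p) * (Rt t r p + p * Rr t r p) = 0"
proof -
  obtain \<beta> where \<beta>: "0 < r" "0 \<le> \<beta>" "f t r p \<beta> \<noteq> 0"
    using assms by (auto simp: radial_base_def)
  obtain \<eta> where \<eta>: "\<eta> > 0" "\<And>b. \<lbrakk>\<beta> \<le> b; b \<le> \<beta> + \<eta>\<rbrakk> \<Longrightarrow> f t r p b \<noteq> 0"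
    using open_angular_momenta[OF \<beta>] by blast
  have "0 < R t r p"
    using R_pos[OF \<open>0 < r\<close>] .
  have main: "Rp t r p = 0 \<and>
      P t r p * Pp t r p * R t r p ^ 3 = r ^ 3 * (Rt t r p + p * Rr t r p) \<and>
      P t r p * (Pt t r p + p * Pr t r p - (Ux \<bullet> e1) * Pp t r p)
      + U' (R t r p) * (Rt t r p + p * Rr t r p) = 0"
    if Ux: "GDERIV (potential (F t)) (r *\<^sub>R e1) :> Ux" for Ux
  proof -
    let ?m = "Ux \<bullet> e1"
    let ?A = "P t r p * (Pt t r p + p * Pr t r p - ?m * Pp t r p)
      + U' (R t r p) * (Rt t r p + p * Rr t r p - ?m * Rp t r p)"
    let ?B = "(P t r p * Pp t r p + U' (R t r p) * Rp t r p) / r ^ 3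
      - (Rt t r p + p * Rr t r p - ?m * Rp t r p) / R t r p ^ 3"
    let ?C = "- (Rp t r p / (R t r p ^ 3 * r ^ 3))"
    have quad: "?A + ?B * b + ?C * b\<^sup>2 = 0" if "\<beta> \<le> b" "b \<le> \<beta> + \<eta>" for b
    proof -
      have "?A + ?B * b + ?C * b\<^sup>2 = P t r p * (Pt t r p + p * Pr t r p + (b / r ^ 3 - ?m) * Pp t r p)
        + (U' (R t r p) - b / R t r p ^ 3) * (Rt t r p + p * Rr t r p + (b / r ^ 3 - ?m) * Rp t r p)"
        using \<open>0 < r\<close> \<open>0 < R t r p\<close> by (simp add: divide_simps) algebra
      also have "\<dots> = 0"
        using that \<beta> by (intro energy_conserved \<eta> Ux) auto
      finally show ?thesis .
    qed
    have "?C = 0" "?B = 0" "?A = 0"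
      using \<open>\<eta> > 0\<close> quadratic_zero_coefficients[of "\<eta> / 2" ?A ?B \<beta> ?C] quad[of \<beta>]
        quad[of "\<beta> + \<eta> / 2"] quad[of "\<beta> + 2 * (\<eta> / 2)"] by auto
    then have "Rp t r p = 0"
      using \<open>0 < r\<close> \<open>0 < R t r p\<close> by simp
    moreover have "P t r p * Pp t r p * R t r p ^ 3 = r ^ 3 * (Rt t r p + p * Rr t r p)"
      using \<open>?B = 0\<close> \<open>0 < r\<close> \<open>0 < R t r p\<close> unfolding \<open>Rp t r p = 0\<close> by (simp add: field_simps)
    ultimately show ?thesis
      using \<open>?A = 0\<close> by simp
  qed
  have "F t (r *\<^sub>R e1) (p *\<^sub>R e1 + (sqrt \<beta> / r) *\<^sub>R e2) \<noteq> 0"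
    using radial_form_axis[OF F \<beta>(1,2)] \<beta>(3) by simp
  from vlasov_poissonD(2)[OF solution this]
  obtain Ux0 where "GDERIV (potential (F t)) (r *\<^sub>R e1) :> Ux0"
    by blast
  from main[OF this] show "Rp t r p = 0"
    "P t r p * Pp t r p * R t r p ^ 3 = r ^ 3 * (Rt t r p + p * Rr t r p)"
    by simp_all
  show "GDERIV (potential (F t)) (r *\<^sub>R e1) :> Ux \<Longrightarrow>
      P t r p * (Pt t r p + p * Pr t r p - (Ux \<bullet> e1) * Pp t r p)
      + U' (R t r p) * (Rt t r p + p * Rr t r p) = 0"
    using main by simp
qed

text \<open>
  The transport equations hold on an open set of space-time, so every point of the base has a box
  on which \<open>linear_of_transport_equations\<close> applies.
\<close>

lemma locally_linear:
  assumes "(r0, p0) \<in> radial_base (f t0)"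
  obtains \<epsilon> c c' where "\<epsilon> > 0"
    "\<And>t r p. \<lbrakk>\<bar>t - t0\<bar> < \<epsilon>; \<bar>r - r0\<bar> < \<epsilon>; \<bar>p - p0\<bar> < \<epsilon>\<rbrakk> \<Longrightarrow>
      (r, p) \<in> radial_base (f t) \<and> 0 < c t \<and> R t r p = c t * r \<and>
      (c has_real_derivative c' t) (at t) \<and> P t r p = p / c t + r * c' t / (c t)\<^sup>2"
proof -
  let ?O = "(\<lambda>(t, r, p). (R t r p, P t r p)) -` radial_base profile \<inter> {(t, r, p). 0 < r}"
  have "continuous_on {(t, r, p). 0 < r} (\<lambda>(t, r, p). (R t r p, P t r p))"
    by (rule continuous_on_subset[OF continuous_Z]) auto
  then have "open ?O"
    using continuous_on_open_vimage[OF open_half_space] open_base by blast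
  moreover have "(t0, r0, p0) \<in> ?O"
    using assms by (simp add: base_iff)
  ultimately obtain V X1 where VX: "open V" "open X1" "(t0, r0, p0) \<in> V \<times> X1" "V \<times> X1 \<subseteq> ?O"
    by (rule open_prod_elim)
  then have "(r0, p0) \<in> X1" "t0 \<in> V"
    by auto
  obtain X Y where XY: "open X" "open Y" "(r0, p0) \<in> X \<times> Y" "X \<times> Y \<subseteq> X1"
    using open_prod_elim[OF \<open>open X1\<close> \<open>(r0, p0) \<in> X1\<close>] by blast
  obtain a where a: "a > 0" "ball t0 a \<subseteq> V"
    using \<open>open V\<close> \<open>t0 \<in> V\<close> open_contains_ball by blast
  obtain b where b: "b > 0" "ball r0 b \<subseteq> X"
    using XY open_contains_ball by blast
  obtain d where d: "d > 0" "ball p0 d \<subseteq> Y"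
    using XY open_contains_ball by blast
  define \<epsilon> where "\<epsilon> = min a (min b d)"
  define B where "B t r p \<longleftrightarrow> \<bar>t - t0\<bar> < \<epsilon> \<and> \<bar>r - r0\<bar> < \<epsilon> \<and> \<bar>p - p0\<bar> < \<epsilon>" for t r p
  have base: "(r, p) \<in> radial_base (f t)" if "B t r p" for t r p
  proof -
    have "t \<in> ball t0 a" "r \<in> ball r0 b" "p \<in> ball p0 d"
      using that by (simp_all add: B_def \<epsilon>_def dist_real_def abs_minus_commute)
    then have "(t, r, p) \<in> ?O"
      using a(2) b(2) d(2) XY(4) VX(4) by blast
    then show ?thesis
      by (simp add: base_iff)
  qed
  then have pos': "0 < r" if "B t r p" for t r p
    using that by (auto simp: base_iff)
  show thesis
  proof (rule that)
    show "\<epsilon> > 0"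
      using a b d by (simp add: \<epsilon>_def)
    fix t r p
    assume "\<bar>t - t0\<bar> < \<epsilon>" "\<bar>r - r0\<bar> < \<epsilon>" "\<bar>p - p0\<bar> < \<epsilon>"
    then have "B t r p"
      by (simp add: B_def)
    have 1: "((\<lambda>s. R t r s) has_real_derivative 0) (at p)" if "B t r p" for t r p
      using partials_R(3)[OF pos'[OF that]] transport_equations(1)[OF base[OF that]] by metis
    have 2: "Rr t r p * Pp t r p = 1" if "B t r p" for t r p
      using jacobian[OF pos'[OF that], of t p] transport_equations(1)[OF base[OF that]] by simp
    have 3: "0 < r \<and> 0 < R t r p" if "B t r p" for t r p
      using pos'[OF that] R_pos by simp
    note lin = linear_of_transport_equations[of B R Rt Rr P Pp t0 \<epsilon> r0 p0 t r p,
        OF partials_R(1)[OF pos'] partials_R(2)[OF pos'] 1 partials_P(3)[OF pos'] 2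
          transport_equations(2)[OF base] 3 B_def \<open>B t r p\<close>]
    \<comment> \<open>The coefficient is \<open>R / r\<close> at the centre of the box.\<close>
    show "(r, p) \<in> radial_base (f t) \<and> 0 < R t r0 p0 / r0 \<and> R t r p = R t r0 p0 / r0 * r \<and>
      ((\<lambda>t. R t r0 p0 / r0) has_real_derivative Rt t r0 p0 / r0) (at t) \<and>
      P t r p = p / (R t r0 p0 / r0) + r * (Rt t r0 p0 / r0) / (R t r0 p0 / r0)\<^sup>2"
      using base[OF \<open>B t r p\<close>] lin by (intro conjI) assumption+
  qed
qed

text \<open>
  The slope \<open>c\<close> and its rate \<open>d\<close>, read off at a single point, determine \<open>(R, P)\<close> over the whole base. The
  map \<open>(\<rho>, \<pi>) \<mapsto> (\<rho> / c, c \<pi> - d \<rho> / c\<^sup>2)\<close> is the inverse of \<open>(r, p) \<mapsto> (c r, p / c + d r / c\<^sup>2)\<close>. The set of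
  \<open>(\<rho>, \<pi>)\<close> at which it inverts \<open>(R, P)\<close> is closed by continuity. It is open because the local
  form of \<open>(R, P)\<close> near the preimage is linear, with coefficients that are forced to be \<open>c\<close> and \<open>d\<close> by
  the values of \<open>R\<close> and \<open>P\<close> there. The argument runs over the base of \<open>Q\<close>, which is connected; for the
  base of \<open>f\<close> this is not known in advance.
\<close>

lemma linear_on_base_from_point:
  assumes z0: "(r0, p0) \<in> radial_base (f t)"
  defines "c \<equiv> R t r0 p0 / r0" and "d \<equiv> Rt t r0 p0 / r0"
  assumes "(\<rho>, \<pi>) \<in> radial_base profile"
  shows "R t (\<rho> / c) (c * \<pi> - d * \<rho> / c\<^sup>2) = \<rho>" "P t (\<rho> / c) (c * \<pi> - d * \<rho> / c\<^sup>2) = \<pi>"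
proof -
  have "0 < r0"
    using z0 by (simp add: base_iff)
  then have "0 < c"
    using R_pos by (simp add: c_def)
  let ?A = "\<lambda>(\<rho>, \<pi>). (\<rho> / c, c * \<pi> - d * \<rho> / c\<^sup>2)"
  let ?G = "\<lambda>(\<rho>, \<pi>). (R t (\<rho> / c) (c * \<pi> - d * \<rho> / c\<^sup>2), P t (\<rho> / c) (c * \<pi> - d * \<rho> / c\<^sup>2))"
  let ?W = "{z \<in> radial_base profile. ?G z - z = 0}"
  have "continuous_on (radial_base profile) (\<lambda>z. (R t (fst z / c) (c * snd z - d * fst z / c\<^sup>2),
      P t (fst z / c) (c * snd z - d * fst z / c\<^sup>2)))"
    using \<open>0 < c\<close> by (intro continuous_Z_comp continuous_intros) (auto simp: radial_base_def)
  then have "continuous_on (radial_base profile) (\<lambda>z. ?G z - z)"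
    by (intro continuous_intros) (simp add: split_def)
  then have closed: "closedin (top_of_set (radial_base profile)) ?W"
    by (rule continuous_closedin_preimage_constant)
  have "open ?W"
  proof (subst open_subopen, intro ballI)
    fix z assume "z \<in> ?W"
    then obtain \<rho> \<pi> where z: "z = (\<rho>, \<pi>)" "(\<rho>, \<pi>) \<in> radial_base profile"
      "R t (\<rho> / c) (c * \<pi> - d * \<rho> / c\<^sup>2) = \<rho>" "P t (\<rho> / c) (c * \<pi> - d * \<rho> / c\<^sup>2) = \<pi>"
      by (cases z) auto
    let ?r = "\<rho> / c" and ?p = "c * \<pi> - d * \<rho> / c\<^sup>2"
    have "0 < \<rho>"
      using z(2) by (simp add: radial_base_def)
    then have "(?r, ?p) \<in> radial_base (f t)"
      using z \<open>0 < c\<close> by (simp add: base_iff)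
    then obtain \<epsilon> b b' where "\<epsilon> > 0" and loc: "\<And>s r p. \<lbrakk>\<bar>s - t\<bar> < \<epsilon>; \<bar>r - ?r\<bar> < \<epsilon>; \<bar>p - ?p\<bar> < \<epsilon>\<rbrakk> \<Longrightarrow>
      (r, p) \<in> radial_base (f s) \<and> 0 < b s \<and> R s r p = b s * r \<and>
      (b has_real_derivative b' s) (at s) \<and> P s r p = p / b s + r * b' s / (b s)\<^sup>2"
      by (rule locally_linear) blast
    have "\<rho> = b t * ?r"
      using loc[of t ?r ?p] \<open>\<epsilon> > 0\<close> z(3) by simp
    \<comment> \<open>The values of \<open>R\<close> and \<open>P\<close> at the preimage determine the local coefficients.\<close>
    then have "b t = c"
      using \<open>0 < \<rho>\<close> \<open>0 < c\<close> by (simp add: field_simps)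
    have "\<pi> = ?p / c + ?r * b' t / c\<^sup>2"
      using loc[of t ?r ?p] \<open>\<epsilon> > 0\<close> z(4) \<open>b t = c\<close> by simp
    then have "b' t = d"
      using \<open>0 < \<rho>\<close> \<open>0 < c\<close> by (simp add: field_simps power2_eq_square)
    let ?N = "{?r - \<epsilon> <..< ?r + \<epsilon>} \<times> {?p - \<epsilon> <..< ?p + \<epsilon>}"
    have "open (?A -` ?N)"
      using \<open>0 < c\<close> by (intro open_vimage open_Times open_greaterThanLessThan)
        (auto simp: split_def intro!: continuous_intros)
    then have "open (radial_base profile \<inter> ?A -` ?N)"
      using open_base by blast
    moreover have "z \<in> radial_base profile \<inter> ?A -` ?N"
      using z(1,2) \<open>\<epsilon> > 0\<close> by simp
    moreover have "radial_base profile \<inter> ?A -` ?N \<subseteq> ?W"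
    proof
      fix w
      assume "w \<in> radial_base profile \<inter> ?A -` ?N"
      then obtain x y where w: "w = (x, y)" and xy: "(x, y) \<in> radial_base profile" "(x, y) \<in> ?A -` ?N"
        by (cases w) blast
      let ?x = "x / c" and ?y = "c * y - d * x / c\<^sup>2"
      have "\<bar>?x - ?r\<bar> < \<epsilon>" "\<bar>?y - ?p\<bar> < \<epsilon>"
        using xy(2) unfolding abs_less_iff by auto
      then have "R t ?x ?y = c * ?x" "P t ?x ?y = ?y / c + ?x * d / c\<^sup>2"
        using loc[of t ?x ?y] \<open>\<epsilon> > 0\<close> \<open>b t = c\<close> \<open>b' t = d\<close> by simp_all
      moreover have "c * ?x = x" "?y / c + ?x * d / c\<^sup>2 = y"
        using \<open>0 < c\<close> by (simp_all add: field_simps power2_eq_square)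
      ultimately show "w \<in> ?W"
        using w xy(1) by simp
    qed
    ultimately show "\<exists>T. open T \<and> z \<in> T \<and> T \<subseteq> ?W"
      by blast
  qed
  then have "openin (top_of_set (radial_base profile)) ?W"
    using open_base by (simp add: openin_open_eq)
  then have "?W = {} \<or> ?W = radial_base profile"
    using connected_base closed unfolding connected_clopen by blast
  moreover
  obtain \<epsilon> b b' where "\<epsilon> > 0" and loc: "\<And>s r p. \<lbrakk>\<bar>s - t\<bar> < \<epsilon>; \<bar>r - r0\<bar> < \<epsilon>; \<bar>p - p0\<bar> < \<epsilon>\<rbrakk> \<Longrightarrow>
      (r, p) \<in> radial_base (f s) \<and> 0 < b s \<and> R s r p = b s * r \<and>
      (b has_real_derivative b' s) (at s) \<and> P s r p = p / b s + r * b' s / (b s)\<^sup>2"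
    using locally_linear[OF z0] by blast
  have "b t = c"
    using loc[of t r0 p0] \<open>\<epsilon> > 0\<close> \<open>0 < r0\<close> by (simp add: c_def)
  have "Rt t r0 p0 = b' t * r0"
  proof -
    have "eventually (\<lambda>s. s \<in> {t - \<epsilon> <..< t + \<epsilon>}) (nhds t)"
      using \<open>\<epsilon> > 0\<close> by (intro eventually_nhds_in_open) auto
    then have ev: "eventually (\<lambda>s. R s r0 p0 = b s * r0) (nhds t)"
    proof (rule eventually_mono)
      fix s assume "s \<in> {t - \<epsilon> <..< t + \<epsilon>}"
      then have "\<bar>s - t\<bar> < \<epsilon>"
        by auto
      then show "R s r0 p0 = b s * r0"
        using loc[of s r0 p0] \<open>\<epsilon> > 0\<close> by simp
    qed
    have "((\<lambda>s. b s * r0) has_real_derivative b' t * r0) (at t)"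
      using loc[of t r0 p0] \<open>\<epsilon> > 0\<close> by (intro DERIV_cmult_right) simp
    then show ?thesis
      using partials_R(1)[OF \<open>0 < r0\<close>] DERIV_cong_ev[OF refl ev refl] DERIV_unique by blast
  qed
  then have "b' t = d"
    using \<open>0 < r0\<close> by (simp add: d_def)
  have "P t r0 p0 = p0 / c + r0 * d / c\<^sup>2" "R t r0 p0 = c * r0"
    using loc[of t r0 p0] \<open>\<epsilon> > 0\<close> \<open>b t = c\<close> \<open>b' t = d\<close> by simp_all
  then have "c * P t r0 p0 - d * R t r0 p0 / c\<^sup>2 = p0" "R t r0 p0 / c = r0"
    using \<open>0 < c\<close> by (simp_all add: field_simps power2_eq_square)
  then have "(R t r0 p0, P t r0 p0) \<in> ?W"
    using z0 by (simp add: base_iff)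
  ultimately have "?W = radial_base profile"
    by blast
  then have "(\<rho>, \<pi>) \<in> ?W"
    using assms(4) by simp
  then show "R t (\<rho> / c) (c * \<pi> - d * \<rho> / c\<^sup>2) = \<rho>" "P t (\<rho> / c) (c * \<pi> - d * \<rho> / c\<^sup>2) = \<pi>"
    by simp_all
qed

text \<open>
  By \<open>linear_on_base_from_point\<close> the slope at any point equals the slope near \<open>r = 0\<close>. The preimages of
  \<open>(c \<delta>, v \<bullet> e1 + d \<delta> / c\<^sup>2)\<close> are \<open>(\<delta>, c (v \<bullet> e1))\<close>: they approach the boundary at a fixed momentum, where
  \<open>R / r\<close> tends to \<open>\<sigma>\<close>.
\<close>

lemma R_eq_sigma:
  assumes z0: "(r0, p0) \<in> radial_base (f t)"
  shows "R t r0 p0 = \<sigma> t * r0"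
proof -
  define c where "c = R t r0 p0 / r0"
  define d where "d = Rt t r0 p0 / r0"
  have "0 < r0"
    using z0 by (simp add: base_iff)
  then have "0 < c"
    using R_pos by (simp add: c_def)
  obtain v where "Q 0 v \<noteq> 0"
    using center_in_support by blast
  then obtain \<epsilon> where "\<epsilon> > 0" and
    \<epsilon>: "\<And>r p. \<lbrakk>0 < r; r < \<epsilon>; \<bar>p - v \<bullet> e1\<bar> < \<epsilon>\<rbrakk> \<Longrightarrow> (r, p) \<in> radial_base profile"
    using radial_base_near_center[OF radial_form_Q open_Q] by blast
  let ?q = "v \<bullet> e1"
  have "((\<lambda>\<delta>. c * \<delta>) \<longlongrightarrow> c * 0) (at_right 0)" "((\<lambda>\<delta>. \<bar>d * \<delta> / c\<^sup>2\<bar>) \<longlongrightarrow> \<bar>d * 0 / c\<^sup>2\<bar>) (at_right 0)"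
    by (intro tendsto_intros; use \<open>0 < c\<close> in simp)+
  then have "eventually (\<lambda>\<delta>. c * \<delta> < \<epsilon>) (at_right 0)" "eventually (\<lambda>\<delta>. \<bar>d * \<delta> / c\<^sup>2\<bar> < \<epsilon>) (at_right 0)"
    using \<open>\<epsilon> > 0\<close> order_tendstoD(2) by fastforce+
  then have "eventually (\<lambda>\<delta>. R t \<delta> (c * ?q) / \<delta> = c) (at_right 0)"
    using eventually_at_right_less[of "0 :: real"]
  proof eventually_elim
    case (elim \<delta>)
    then have "(c * \<delta>, ?q + d * \<delta> / c\<^sup>2) \<in> radial_base profile"
      using \<epsilon> \<open>0 < c\<close> by simp
    from linear_on_base_from_point(1)[OF z0, folded c_def d_def, OF this]
    have "R t \<delta> (c * (?q + d * \<delta> / c\<^sup>2) - d * (c * \<delta>) / c\<^sup>2) = c * \<delta>"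
      using \<open>0 < c\<close> by simp
    moreover have "c * (?q + d * \<delta> / c\<^sup>2) - d * (c * \<delta>) / c\<^sup>2 = c * ?q"
      by (simp add: algebra_simps)
    ultimately show ?case
      using elim by simp
  qed
  then have "((\<lambda>\<delta>. R t \<delta> (c * ?q) / \<delta>) \<longlongrightarrow> c) (at_right 0)"
    by (rule tendsto_eventually)
  with R_over_r have "\<sigma> t = c"
    by (rule tendsto_unique[rotated]) simp
  then show ?thesis
    using \<open>0 < r0\<close> by (simp add: c_def)
qed

lemma base_stable:
  assumes "(r, p) \<in> radial_base (f t)"
  shows "eventually (\<lambda>s. (r, p) \<in> radial_base (f s)) (nhds t)"
proof -
  obtain \<epsilon> where "\<epsilon> > 0" "\<And>s. \<bar>s - t\<bar> < \<epsilon> \<Longrightarrow> (r, p) \<in> radial_base (f s)"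
    using locally_linear[OF assms] by (metis abs_zero cancel_comm_monoid_add_class.diff_cancel)
  then show ?thesis
    by (auto simp: eventually_nhds_metric dist_real_def)
qed

text \<open>
  A point of the base stays in it for a short time, so \<open>\<sigma>\<close> coincides locally with \<open>R / r\<close> at a fixed
  point and inherits its regularity.
\<close>

lemma sigma_derivative:
  assumes "(r, p) \<in> radial_base (f t)"
  shows "(\<sigma> has_real_derivative Rt t r p / r) (at t)"
proof -
  have "0 < r"
    using assms by (simp add: base_iff)
  have ev: "eventually (\<lambda>s. \<sigma> s = R s r p / r) (nhds t)"
    using base_stable[OF assms] by (rule eventually_mono) (use \<open>0 < r\<close> R_eq_sigma in simp)
  show ?thesis
    using partials_R(1)[OF \<open>0 < r\<close>] DERIV_cong_ev[OF refl ev refl] DERIV_cdivide by blast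
qed

lemma Rt_eq_sigma:
  assumes "(r, p) \<in> radial_base (f t)"
  shows "Rt t r p = deriv \<sigma> t * r"
  using DERIV_imp_deriv[OF sigma_derivative[OF assms]] assms by (simp add: base_iff)

lemma R_boundary: "R t 0 p = 0"
proof -
  have "continuous_on {0..} (\<lambda>r. (R t r p, P t r p))"
    by (rule continuous_Z_comp) (auto intro!: continuous_intros)
  then have "continuous_on {0..} (\<lambda>r. R t r p)"
    using continuous_on_fst by fastforce
  then show ?thesis
    using zero_of_finite_slope[OF _ R_over_r] by simp
qed

text \<open>
  At \<open>r = 0\<close> the partial derivatives of \<open>R\<close> are known: \<open>R\<close> vanishes there and has slope \<open>\<sigma>\<close>.
\<close>

lemma boundary_partials: "Rr t 0 p = \<sigma> t" "Rp t 0 p = 0" "((\<lambda>p. P t 0 p) has_real_derivative Pp t 0 p) (at p)"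
proof -
  let ?S = "{(t :: real, r :: real, p :: real). 0 \<le> r}"
  have "((\<lambda>r. (t, r, p)) has_derivative (\<lambda>a. (0, a, 0))) (at 0 within {0..})"
    "((\<lambda>p. (t, 0, p)) has_derivative (\<lambda>a. (0, 0, a))) (at p)"
    by (auto intro!: derivative_eq_intros simp: zero_prod_def)
  note lines = this
  have "((\<lambda>r. (\<lambda>(t, r, p). R t r p) (t, r, p)) has_derivative
      (\<lambda>a. (\<lambda>(a, b, c). a * Rt t 0 p + b * Rr t 0 p + c * Rp t 0 p) (0, a, 0))) (at 0 within {0..})"
    using dR_within[of 0 t p] by (intro has_derivative_in_compose[OF lines(1)])
      (auto intro: has_derivative_subset)
  then have "((\<lambda>r. R t r p) has_real_derivative Rr t 0 p) (at 0 within {0..})"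
    unfolding prod.case by (rule has_derivative_imp_has_field_derivative) simp
  then have "((\<lambda>r. R t r p / r) \<longlongrightarrow> Rr t 0 p) (at 0 within {0..})"
    by (simp add: has_field_derivative_iff R_boundary)
  then have "((\<lambda>r. R t r p / r) \<longlongrightarrow> Rr t 0 p) (at_right 0)"
    by (rule tendsto_within_subset) auto
  from tendsto_unique[OF _ this R_over_r] show "Rr t 0 p = \<sigma> t"
    by simp
  have "((\<lambda>p. (\<lambda>(t, r, p). R t r p) (t, 0, p)) has_derivative
      (\<lambda>a. (\<lambda>(a, b, c). a * Rt t 0 p + b * Rr t 0 p + c * Rp t 0 p) (0, 0, a))) (at p)"
    using dR_within[of 0 t p] by (intro has_derivative_in_compose[OF lines(2)])
      (auto intro: has_derivative_subset)
  then have "((\<lambda>p. R t 0 p) has_real_derivative Rp t 0 p) (at p)"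
    unfolding prod.case by (rule has_derivative_imp_has_field_derivative) simp
  then have "((\<lambda>p. 0) has_real_derivative Rp t 0 p) (at p)"
    by (simp only: R_boundary)
  then show "Rp t 0 p = 0"
    using DERIV_unique DERIV_const by blast
  have "((\<lambda>p. (\<lambda>(t, r, p). P t r p) (t, 0, p)) has_derivative
      (\<lambda>a. (\<lambda>(a, b, c). a * Pt t 0 p + b * Pr t 0 p + c * Pp t 0 p) (0, 0, a))) (at p)"
    using dP_within[of 0 t p] by (intro has_derivative_in_compose[OF lines(2)])
      (auto intro: has_derivative_subset)
  then show "((\<lambda>p. P t 0 p) has_real_derivative Pp t 0 p) (at p)"
    unfolding prod.case by (rule has_derivative_imp_has_field_derivative) simp
qed

text \<open>
  The Jacobian identity extended by continuity to \<open>r = 0\<close>.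
\<close>

lemma sigma_Pp: "\<sigma> t * Pp t 0 p = 1"
proof -
  have lim: "((\<lambda>r. g t r p) \<longlongrightarrow> g t 0 p) (at_right 0)"
    if "continuous_on {(t, r, p). 0 \<le> r} (\<lambda>(t, r, p). g t r p)" for g :: "real \<Rightarrow> real \<Rightarrow> real \<Rightarrow> real"
  proof -
    have "continuous_on {0..} (\<lambda>r. (\<lambda>(t, r, p). g t r p) (t, r, p))"
      using that by (rule continuous_on_compose2) (auto intro!: continuous_intros)
    then show ?thesis
      by (auto simp: continuous_on_def intro: tendsto_within_subset)
  qed
  have "((\<lambda>r. Rr t r p * Pp t r p - Rp t r p * Pr t r p) \<longlongrightarrow>
      Rr t 0 p * Pp t 0 p - Rp t 0 p * Pr t 0 p) (at_right 0)"
    by (intro tendsto_intros lim continuous_partials)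
  moreover have "((\<lambda>r. Rr t r p * Pp t r p - Rp t r p * Pr t r p) \<longlongrightarrow> 1) (at_right 0)"
    by (rule tendsto_eventually) (auto simp: eventually_at_filter jacobian)
  ultimately have "Rr t 0 p * Pp t 0 p - Rp t 0 p * Pr t 0 p = 1"
    by (rule tendsto_unique[rotated]) simp
  then show ?thesis
    by (simp add: boundary_partials)
qed

lemma sigma_nonzero: "\<sigma> t \<noteq> 0"
  using sigma_Pp[of t 0] by auto

lemma P_boundary: "P t 0 p = P t 0 0 + p / \<sigma> t"
proof -
  have "P t 0 p - p / \<sigma> t = P t 0 0 - 0 / \<sigma> t"
  proof (rule DERIV_isconst_all[of "\<lambda>p. P t 0 p - p / \<sigma> t"], intro allI)
    fix p
    have "((\<lambda>p. P t 0 p - p / \<sigma> t) has_real_derivative Pp t 0 p - 1 / \<sigma> t) (at p)"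
      by (intro DERIV_diff boundary_partials DERIV_cdivide DERIV_ident)
    moreover have "Pp t 0 p - 1 / \<sigma> t = 0"
      using sigma_Pp[of t p] sigma_nonzero[of t] by (simp add: field_simps)
    ultimately show "((\<lambda>p. P t 0 p - p / \<sigma> t) has_real_derivative 0) (at p)"
      by simp
  qed
  then show ?thesis
    by simp
qed

text \<open>
  \<open>P(t, 0, \<cdot>)\<close> is affine with slope \<open>1 / \<sigma>\<close> and so takes the value \<open>v \<bullet> e1\<close> of a central particle of \<open>Q\<close>.
  Close to that boundary point \<open>(R, P)\<close> enters the half neighbourhood of \<open>radial_base_near_center\<close>.
\<close>

lemma base_nonempty: "\<exists>r p. (r, p) \<in> radial_base (f t)"
proof -
  obtain v where "Q 0 v \<noteq> 0"
    using center_in_support by blast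
  then obtain \<epsilon> where "\<epsilon> > 0" and
    \<epsilon>: "\<And>r p. \<lbrakk>0 < r; r < \<epsilon>; \<bar>p - v \<bullet> e1\<bar> < \<epsilon>\<rbrakk> \<Longrightarrow> (r, p) \<in> radial_base profile"
    using radial_base_near_center[OF radial_form_Q open_Q] by blast
  \<comment> \<open>The momentum for which \<open>P(t, 0, p) = v \<bullet> e1\<close>.\<close>
  define p where "p = \<sigma> t * (v \<bullet> e1 - P t 0 0)"
  have P0: "P t 0 p = v \<bullet> e1"
    by (subst P_boundary) (simp add: p_def sigma_nonzero)
  have "continuous_on {0..} (\<lambda>r. (R t r p, P t r p))"
    by (rule continuous_Z_comp) (auto intro!: continuous_intros)
  then have "((\<lambda>r. (R t r p, P t r p)) \<longlongrightarrow> (R t 0 p, P t 0 p)) (at_right 0)"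
    by (auto simp: continuous_on_def intro: tendsto_within_subset)
  then have lim: "((\<lambda>r. (R t r p, P t r p)) \<longlongrightarrow> (0, v \<bullet> e1)) (at_right 0)"
    by (simp only: P0 R_boundary)
  have "eventually (\<lambda>r. R t r p < \<epsilon>) (at_right 0)"
    using tendsto_fst[OF lim] \<open>\<epsilon> > 0\<close> by (auto intro: order_tendstoD)
  moreover have "eventually (\<lambda>r. dist (P t r p) (v \<bullet> e1) < \<epsilon>) (at_right 0)"
    using tendstoD[OF tendsto_snd[OF lim] \<open>\<epsilon> > 0\<close>] by simp
  ultimately have "eventually (\<lambda>r. (r, p) \<in> radial_base (f t)) (at_right 0)"
    using eventually_at_right_less[of "0 :: real"]
  proof eventually_elim
    case (elim r)
    then show ?case
      using \<epsilon> R_pos by (simp add: base_iff dist_real_def)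
  qed
  then show ?thesis
    using eventually_happens by (metis trivial_limit_at_right_real)
qed

lemma sigma_pos: "0 < \<sigma> t"
proof -
  obtain r p where z: "(r, p) \<in> radial_base (f t)"
    using base_nonempty by blast
  then have r: "0 < r"
    by (simp add: base_iff)
  have "0 < R t r p"
    by (rule R_pos[OF r])
  then have "0 < \<sigma> t * r"
    by (simp add: R_eq_sigma[OF z])
  then show ?thesis
    using r by (simp add: zero_less_mult_iff)
qed

lemma linear_on_base:
  assumes "(\<rho>, \<pi>) \<in> radial_base profile"
  shows "R t (\<rho> / \<sigma> t) (\<sigma> t * \<pi> - deriv \<sigma> t * \<rho> / (\<sigma> t)\<^sup>2) = \<rho>"
    "P t (\<rho> / \<sigma> t) (\<sigma> t * \<pi> - deriv \<sigma> t * \<rho> / (\<sigma> t)\<^sup>2) = \<pi>"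
    "(\<rho> / \<sigma> t, \<sigma> t * \<pi> - deriv \<sigma> t * \<rho> / (\<sigma> t)\<^sup>2) \<in> radial_base (f t)"
proof -
  obtain r0 p0 where z0: "(r0, p0) \<in> radial_base (f t)"
    using base_nonempty by blast
  then have "0 < r0"
    by (simp add: base_iff)
  then have "R t r0 p0 / r0 = \<sigma> t" "Rt t r0 p0 / r0 = deriv \<sigma> t"
    using R_eq_sigma[OF z0] Rt_eq_sigma[OF z0] by simp_all
  with linear_on_base_from_point[OF z0 assms]
  show lin: "R t (\<rho> / \<sigma> t) (\<sigma> t * \<pi> - deriv \<sigma> t * \<rho> / (\<sigma> t)\<^sup>2) = \<rho>"
    "P t (\<rho> / \<sigma> t) (\<sigma> t * \<pi> - deriv \<sigma> t * \<rho> / (\<sigma> t)\<^sup>2) = \<pi>"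
    by simp_all
  show "(\<rho> / \<sigma> t, \<sigma> t * \<pi> - deriv \<sigma> t * \<rho> / (\<sigma> t)\<^sup>2) \<in> radial_base (f t)"
    unfolding base_iff lin using assms sigma_pos by (simp add: radial_base_def)
qed

text \<open>
  The coefficients of the local linear form agree with \<open>\<sigma>\<close> for all nearby times, hence so does the
  derivative.
\<close>

lemma P_eq_sigma:
  assumes "(r, p) \<in> radial_base (f t)"
  shows "P t r p = p / \<sigma> t + deriv \<sigma> t * r / (\<sigma> t)\<^sup>2"
proof -
  have "0 < r"
    using assms by (simp add: base_iff)
  obtain \<epsilon> b b' where "\<epsilon> > 0" and loc: "\<And>s r' p'. \<lbrakk>\<bar>s - t\<bar> < \<epsilon>; \<bar>r' - r\<bar> < \<epsilon>; \<bar>p' - p\<bar> < \<epsilon>\<rbrakk> \<Longrightarrow>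
      (r', p') \<in> radial_base (f s) \<and> 0 < b s \<and> R s r' p' = b s * r' \<and>
      (b has_real_derivative b' s) (at s) \<and> P s r' p' = p' / b s + r' * b' s / (b s)\<^sup>2"
    using locally_linear[OF assms] by blast
  have ev: "eventually (\<lambda>s. b s = \<sigma> s) (nhds t)"
    unfolding eventually_nhds_metric dist_real_def
  proof (intro exI conjI allI impI)
    fix s assume "\<bar>s - t\<bar> < \<epsilon>"
    then have "(r, p) \<in> radial_base (f s)" "R s r p = b s * r"
      using loc[of s r p] \<open>\<epsilon> > 0\<close> by simp_all
    then show "b s = \<sigma> s"
      using R_eq_sigma[of r p s] \<open>0 < r\<close> by simp
  qed fact
  have "b t = \<sigma> t"
    using eventually_nhds_x_imp_x[OF ev] .
  moreover have "(\<sigma> has_real_derivative b' t) (at t)"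
    using loc[of t r p] \<open>\<epsilon> > 0\<close> DERIV_cong_ev[OF refl ev refl] by simp
  then have "b' t = deriv \<sigma> t"
    by (simp add: DERIV_imp_deriv)
  ultimately show ?thesis
    using loc[of t r p] \<open>\<epsilon> > 0\<close> by (simp add: mult.commute)
qed

text \<open>
  On the support this is the linear form of \<open>(R, P)\<close> rewritten in Cartesian variables. Off the support both
  sides vanish: \<open>linear_on_base\<close> says that every point of the base of \<open>Q\<close> is reached from the base of \<open>f\<close>.
\<close>

lemma F_rescaled:
  assumes "x \<noteq> 0"
  shows "F t x v = Q (\<sigma> t *\<^sub>R x) ((1 / \<sigma> t) *\<^sub>R v + (deriv \<sigma> t / (\<sigma> t)\<^sup>2) *\<^sub>R x)"
proof -
  define r where "r = norm x"
  define p where "p = x \<bullet> v / r"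
  define \<beta> where "\<beta> = ang_mom_sq x v"
  define g where "g = deriv \<sigma> t / (\<sigma> t)\<^sup>2"
  have "0 < r" "0 \<le> \<beta>"
    using assms ang_mom_sq_nonneg by (simp_all add: r_def \<beta>_def)
  have s: "0 < \<sigma> t"
    by (rule sigma_pos)
  let ?y = "\<sigma> t *\<^sub>R x" and ?w = "(1 / \<sigma> t) *\<^sub>R v + g *\<^sub>R x"
  have norm: "norm ?y = \<sigma> t * r"
    using s by (simp add: r_def)
  have "?y \<bullet> ?w = r * (p + \<sigma> t * g * r)"
    using s \<open>0 < r\<close> by (simp add: inner_simps p_def r_def power2_norm_eq_inner[symmetric] power2_eq_square algebra_simps)
  then have inner: "?y \<bullet> ?w / norm ?y = p / \<sigma> t + g * r"
    unfolding norm using s \<open>0 < r\<close> by (simp add: field_simps)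
  have Fx: "F t x v = f t r p \<beta>"
    using F[of t] assms by (simp add: radial_form_def r_def p_def \<beta>_def)
  have "?y \<noteq> 0"
    using s assms by simp
  then have Qy: "Q ?y ?w = profile (\<sigma> t * r) (p / \<sigma> t + g * r) \<beta>"
    using radial_form_Q norm inner ang_mom_sq_rescale[of "\<sigma> t" x v g] s
    by (simp add: radial_form_def \<beta>_def)
  show ?thesis
  proof (cases "(r, p) \<in> radial_base (f t)")
    case True
    have "R t r p = \<sigma> t * r" "P t r p = p / \<sigma> t + g * r"
      using R_eq_sigma[OF True] P_eq_sigma[OF True] by (simp_all add: g_def)
    then show ?thesis
      using Fx Qy f[OF \<open>0 < r\<close> \<open>0 \<le> \<beta>\<close>, of t p] by (simp add: g_def)
  next
    case False
    have "profile (\<sigma> t * r) (p / \<sigma> t + g * r) \<beta> = 0"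
    proof (rule ccontr)
      assume "profile (\<sigma> t * r) (p / \<sigma> t + g * r) \<beta> \<noteq> 0"
      then have "(\<sigma> t * r, p / \<sigma> t + g * r) \<in> radial_base profile"
        using s \<open>0 < r\<close> \<open>0 \<le> \<beta>\<close> by (auto simp: radial_base_def)
      from linear_on_base(3)[OF this, of t]
      have "(\<sigma> t * r / \<sigma> t, \<sigma> t * (p / \<sigma> t + g * r) - deriv \<sigma> t * (\<sigma> t * r) / (\<sigma> t)\<^sup>2)
          \<in> radial_base (f t)" .
      moreover have "\<sigma> t * r / \<sigma> t = r"
        "\<sigma> t * (p / \<sigma> t + g * r) - deriv \<sigma> t * (\<sigma> t * r) / (\<sigma> t)\<^sup>2 = p"
        using s by (simp_all add: g_def field_simps power2_eq_square)
      ultimately show False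
        using False by simp
    qed
    moreover have "f t r p \<beta> = 0"
      using False \<open>0 < r\<close> \<open>0 \<le> \<beta>\<close> by (auto simp: radial_base_def)
    ultimately show ?thesis
      using Fx Qy by (simp add: g_def)
  qed
qed

lemma potential_F: "potential (F t) x = \<sigma> t * U (\<sigma> t * norm x)"
proof -
  have "potential (F t) x = \<sigma> t * potential Q (\<sigma> t *\<^sub>R x)"
    by (rule potential_rescale[OF vlasov_poisson_integrable[OF steady]
          vlasov_poisson_integrable(2)[OF solution] sigma_pos F_rescaled])
  then show ?thesis
    using sigma_pos[of t] by (simp add: U)
qed

text \<open>
  Differentiate \<open>U\<^sub>f = \<sigma> U(\<sigma> r)\<close> along the axis \<open>e1\<close>.
\<close>

lemma radial_force:
  assumes Ux: "GDERIV (potential (F t)) (r *\<^sub>R e1) :> Ux" and "0 < r"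
  shows "Ux \<bullet> e1 = (\<sigma> t)\<^sup>2 * U' (\<sigma> t * r)"
proof -
  have "((\<lambda>s. s *\<^sub>R e1) has_derivative (\<lambda>a. a *\<^sub>R e1)) (at r)"
    by (auto intro!: derivative_eq_intros)
  from has_derivative_compose[OF this Ux[unfolded gderiv_def]]
  have 1: "((\<lambda>s. potential (F t) (s *\<^sub>R e1)) has_real_derivative Ux \<bullet> e1) (at r)"
    by (rule has_derivative_imp_has_field_derivative) (simp add: inner_commute)
  have "0 < \<sigma> t * r"
    using sigma_pos \<open>0 < r\<close> by simp
  have "((\<lambda>s. \<sigma> t * s) has_real_derivative \<sigma> t) (at r)"
    by (auto intro!: derivative_eq_intros)
  from DERIV_cmult[OF DERIV_chain2[OF U'_at[OF \<open>0 < \<sigma> t * r\<close>] this]]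
  have 2: "((\<lambda>s. \<sigma> t * U (\<sigma> t * s)) has_real_derivative \<sigma> t * (U' (\<sigma> t * r) * \<sigma> t)) (at r)" .
  have "eventually (\<lambda>s. s \<in> {0<..}) (nhds r)"
    using \<open>0 < r\<close> by (intro eventually_nhds_in_open) auto
  then have ev: "eventually (\<lambda>s. potential (F t) (s *\<^sub>R e1) = \<sigma> t * U (\<sigma> t * s)) (nhds r)"
    by (rule eventually_mono) (simp add: potential_F)
  have "Ux \<bullet> e1 = \<sigma> t * (U' (\<sigma> t * r) * \<sigma> t)"
    using 1 2 DERIV_cong_ev[OF refl ev refl] DERIV_unique by blast
  then show ?thesis
    by (simp add: power2_eq_square algebra_simps)
qed

lemma base_open:
  assumes "(r, p) \<in> radial_base (f t)"
  shows "eventually (\<lambda>s. (s, p) \<in> radial_base (f t)) (nhds r)"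
    "eventually (\<lambda>q. (r, q) \<in> radial_base (f t)) (nhds p)"
proof -
  obtain \<epsilon> where "\<epsilon> > 0"
    "\<And>s q. \<lbrakk>\<bar>s - r\<bar> < \<epsilon>; \<bar>q - p\<bar> < \<epsilon>\<rbrakk> \<Longrightarrow> (s, q) \<in> radial_base (f t)"
    using locally_linear[OF assms] by (metis abs_zero cancel_comm_monoid_add_class.diff_cancel)
  then show "eventually (\<lambda>s. (s, p) \<in> radial_base (f t)) (nhds r)"
    "eventually (\<lambda>q. (r, q) \<in> radial_base (f t)) (nhds p)"
    by (auto simp: eventually_nhds_metric dist_real_def)
qed

lemma sigma_has_derivative: "(\<sigma> has_real_derivative deriv \<sigma> t) (at t)"
proof -
  obtain r p where "(r, p) \<in> radial_base (f t)"
    using base_nonempty by blast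
  from sigma_derivative[OF this] show ?thesis
    by (simp add: DERIV_imp_deriv)
qed

lemma sigma_twice_differentiable: "\<exists>D. (deriv \<sigma> has_real_derivative D) (at t)"
proof -
  obtain r p where z: "(r, p) \<in> radial_base (f t)"
    using base_nonempty by blast
  then have "0 < r"
    by (simp add: base_iff)
  have ev: "eventually (\<lambda>s. deriv \<sigma> s = Rt s r p / r) (nhds t)"
    using base_stable[OF z] by (rule eventually_mono) (use \<open>0 < r\<close> Rt_eq_sigma in simp)
  have "((\<lambda>s. Rt s r p / r) has_real_derivative Rtt t r p / r) (at t)"
    using Rtt[OF \<open>0 < r\<close>] by (rule DERIV_cdivide)
  then show ?thesis
    using DERIV_cong_ev[OF refl ev refl] by blast
qed

lemma sigma_quotient_derivative:
  assumes D: "(deriv \<sigma> has_real_derivative D) (at t)"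
  shows "((\<lambda>x. deriv \<sigma> x / (\<sigma> x)\<^sup>2) has_real_derivative
    D / (\<sigma> t)\<^sup>2 - 2 * (deriv \<sigma> t)\<^sup>2 / (\<sigma> t) ^ 3) (at t)"
proof -
  have sq: "((\<lambda>x. (\<sigma> x)\<^sup>2) has_real_derivative 2 * \<sigma> t * deriv \<sigma> t) (at t)"
    using DERIV_power[OF sigma_has_derivative[of t], of 2] by (simp add: ac_simps)
  have "((\<lambda>x. deriv \<sigma> x / (\<sigma> x)\<^sup>2) has_real_derivative
      (D * (\<sigma> t)\<^sup>2 - deriv \<sigma> t * (2 * \<sigma> t * deriv \<sigma> t)) / ((\<sigma> t)\<^sup>2 * (\<sigma> t)\<^sup>2)) (at t)"
    using sigma_nonzero by (intro DERIV_divide D sq) simp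
  also have "(D * (\<sigma> t)\<^sup>2 - deriv \<sigma> t * (2 * \<sigma> t * deriv \<sigma> t)) / ((\<sigma> t)\<^sup>2 * (\<sigma> t)\<^sup>2)
      = D / (\<sigma> t)\<^sup>2 - 2 * (deriv \<sigma> t)\<^sup>2 / (\<sigma> t) ^ 3"
    using sigma_nonzero[of t] by (simp add: field_simps power2_eq_square power3_eq_cube)
  finally show ?thesis .
qed

text \<open>
  Insert the linear form of \<open>(R, P)\<close> and the force into the third transport equation. As
  \<open>\<partial>\<^sub>t R + p \<partial>\<^sub>r R = \<sigma>\<^sup>2 P\<close>, the whole equation is a multiple of \<open>P\<close>, which can be cancelled.
\<close>

lemma force_balance_nonzero_momentum:
  assumes z: "(r, p) \<in> radial_base (f t)" and D: "(deriv \<sigma> has_real_derivative D) (at t)"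
    and "P t r p \<noteq> 0"
  shows "r * (D / (\<sigma> t)\<^sup>2 - 2 * (deriv \<sigma> t)\<^sup>2 / (\<sigma> t) ^ 3) = (\<sigma> t - (\<sigma> t)\<^sup>2) * U' (\<sigma> t * r)"
proof -
  define s where "s = \<sigma> t"
  define s' where "s' = deriv \<sigma> t"
  have "0 < s"
    unfolding s_def by (rule sigma_pos)
  obtain \<beta> where \<beta>: "0 < r" "0 \<le> \<beta>" "f t r p \<beta> \<noteq> 0"
    using z by (auto simp: radial_base_def)
  have R: "R t r p = s * r" and Rt: "Rt t r p = s' * r" and P: "P t r p = p / s + s' * r / s\<^sup>2"
    using R_eq_sigma[OF z] Rt_eq_sigma[OF z] P_eq_sigma[OF z] by (simp_all add: s_def s'_def)
  have ev: "eventually (\<lambda>x. R t x p = s * x) (nhds r)"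
    using base_open(1)[OF z] by (rule eventually_mono) (simp add: R_eq_sigma s_def)
  have "((\<lambda>x. s * x) has_real_derivative s) (at r)"
    by (auto intro!: derivative_eq_intros)
  then have Rr: "Rr t r p = s"
    using partials_R(2)[OF \<open>0 < r\<close>] DERIV_cong_ev[OF refl ev refl] DERIV_unique by blast
  have "Rp t r p = 0"
    using transport_equations(1)[OF z] .
  then have Pp: "Pp t r p = 1 / s"
    using jacobian[OF \<open>0 < r\<close>, where t = t and p = p] \<open>0 < s\<close> by (simp add: Rr field_simps)
  have ev: "eventually (\<lambda>x. P t x p = p / s + s' * x / s\<^sup>2) (nhds r)"
    using base_open(1)[OF z] by (rule eventually_mono) (simp add: P_eq_sigma s_def s'_def)
  have "((\<lambda>x. p / s + s' * x / s\<^sup>2) has_real_derivative 0 + s' * 1 / s\<^sup>2) (at r)"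
    by (intro DERIV_add DERIV_const DERIV_cdivide DERIV_cmult DERIV_ident)
  then have "((\<lambda>x. p / s + s' * x / s\<^sup>2) has_real_derivative s' / s\<^sup>2) (at r)"
    by simp
  then have Pr: "Pr t r p = s' / s\<^sup>2"
    using partials_P(2)[OF \<open>0 < r\<close>] DERIV_cong_ev[OF refl ev refl] DERIV_unique by blast
  have ev: "eventually (\<lambda>x. P x r p = p / \<sigma> x + deriv \<sigma> x * r / (\<sigma> x)\<^sup>2) (nhds t)"
    using base_stable[OF z] by (rule eventually_mono) (simp add: P_eq_sigma)
  have "((\<lambda>x. p / \<sigma> x) has_real_derivative - (p * s' / s\<^sup>2)) (at t)"
    using \<open>0 < s\<close> unfolding s_def s'_def
    by (auto intro!: derivative_eq_intros sigma_has_derivative simp: power2_eq_square)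
  moreover have "((\<lambda>x. deriv \<sigma> x * r / (\<sigma> x)\<^sup>2) has_real_derivative
      r * (D / s\<^sup>2 - 2 * s'\<^sup>2 / s ^ 3)) (at t)"
    using DERIV_cmult[OF sigma_quotient_derivative[OF D], of r]
    by (simp add: s_def s'_def mult.commute)
  ultimately have "((\<lambda>x. p / \<sigma> x + deriv \<sigma> x * r / (\<sigma> x)\<^sup>2) has_real_derivative
      - (p * s' / s\<^sup>2) + r * (D / s\<^sup>2 - 2 * s'\<^sup>2 / s ^ 3)) (at t)"
    by (rule DERIV_add)
  then have Pt: "Pt t r p = - (p * s' / s\<^sup>2) + r * (D / s\<^sup>2 - 2 * s'\<^sup>2 / s ^ 3)"
    using partials_P(1)[OF \<open>0 < r\<close>] DERIV_cong_ev[OF refl ev refl] DERIV_unique by blast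
  have "F t (r *\<^sub>R e1) (p *\<^sub>R e1 + (sqrt \<beta> / r) *\<^sub>R e2) \<noteq> 0"
    using radial_form_axis[OF F \<beta>(1,2)] \<beta>(3) by simp
  from vlasov_poissonD(2)[OF solution this]
  obtain Ux where Ux: "GDERIV (potential (F t)) (r *\<^sub>R e1) :> Ux"
    by blast
  have m: "Ux \<bullet> e1 = s\<^sup>2 * U' (s * r)"
    using radial_force[OF Ux \<open>0 < r\<close>] by (simp add: s_def)
  have "P t r p * (Pt t r p + p * Pr t r p - (Ux \<bullet> e1) * Pp t r p)
      + U' (R t r p) * (Rt t r p + p * Rr t r p) = 0"
    using transport_equations(3)[OF z Ux] .
  moreover have "Pt t r p + p * Pr t r p = r * (D / s\<^sup>2 - 2 * s'\<^sup>2 / s ^ 3)"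
    by (simp add: Pt Pr)
  moreover have "(Ux \<bullet> e1) * Pp t r p = s * U' (s * r)"
    using \<open>0 < s\<close> by (simp add: m Pp power2_eq_square)
  moreover have "Rt t r p + p * Rr t r p = s\<^sup>2 * P t r p"
    using \<open>0 < s\<close> by (simp add: Rt Rr P field_simps power2_eq_square)
  ultimately have "P t r p * (r * (D / s\<^sup>2 - 2 * s'\<^sup>2 / s ^ 3) - s * U' (s * r) + s\<^sup>2 * U' (s * r)) = 0"
    by (simp add: R algebra_simps)
  then have "r * (D / s\<^sup>2 - 2 * s'\<^sup>2 / s ^ 3) - s * U' (s * r) + s\<^sup>2 * U' (s * r) = 0"
    using \<open>P t r p \<noteq> 0\<close> by simp
  then show ?thesis
    unfolding s_def s'_def by (simp add: algebra_simps)
qed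

text \<open>
  Both sides depend on time and radius alone. So at a point with \<open>P = 0\<close> the momentum may be changed slightly
  within the base, which makes \<open>P\<close> nonzero. The radius is \<open>\<rho> = \<sigma> r\<close>.
\<close>

lemma force_balance:
  assumes z: "(\<rho>, \<pi>) \<in> radial_base profile" and D: "(deriv \<sigma> has_real_derivative D) (at t)"
  shows "\<rho> * (D / (\<sigma> t)\<^sup>2 - 2 * (deriv \<sigma> t)\<^sup>2 / (\<sigma> t) ^ 3) = ((\<sigma> t)\<^sup>2 - (\<sigma> t) ^ 3) * U' \<rho>"
proof -
  define r where "r = \<rho> / \<sigma> t"
  obtain p where rp: "(r, p) \<in> radial_base (f t)"
    using linear_on_base(3)[OF z, of t] unfolding r_def by blast
  have \<rho>: "\<rho> = \<sigma> t * r"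
    using sigma_pos[of t] by (simp add: r_def)
  have "\<exists>q. (r, q) \<in> radial_base (f t) \<and> P t r q \<noteq> 0"
  proof (cases "P t r p = 0")
    case True
    have "eventually (\<lambda>q. q \<noteq> p \<and> (r, q) \<in> radial_base (f t)) (at p)"
      using base_open(2)[OF rp] by (auto simp: eventually_at_filter elim: eventually_mono)
    then obtain q where q: "q \<noteq> p" "(r, q) \<in> radial_base (f t)"
      using eventually_happens'[OF trivial_limit_at] by blast
    have "P t r q = P t r q - P t r p"
      using True by simp
    also have "\<dots> = (q - p) / \<sigma> t"
      using P_eq_sigma[OF q(2)] P_eq_sigma[OF rp] by (simp add: diff_divide_distrib)
    finally show ?thesis
      using q sigma_pos[of t] by auto
  qed (use rp in blast)
  then obtain q where "(r, q) \<in> radial_base (f t)" "P t r q \<noteq> 0"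
    by blast
  from force_balance_nonzero_momentum[OF this(1) D this(2)]
  have "\<sigma> t * (r * (D / (\<sigma> t)\<^sup>2 - 2 * (deriv \<sigma> t)\<^sup>2 / (\<sigma> t) ^ 3))
      = \<sigma> t * ((\<sigma> t - (\<sigma> t)\<^sup>2) * U' \<rho>)"
    unfolding \<rho> by (rule arg_cong)
  then show ?thesis
    by (simp add: \<rho> algebra_simps power2_eq_square power3_eq_cube)
qed

text \<open>
  Divide the balance by \<open>\<rho>\<close> and let \<open>\<rho> \<rightarrow> 0\<close>, where \<open>U'(\<rho>) / \<rho>\<close> tends to \<open>\<alpha>\<close>. With \<open>\<phi> = 1 / \<sigma>\<close> the left-hand side
  is \<open>- \<phi>''\<close>.
\<close>

lemma sigma_ode:
  assumes D: "(deriv \<sigma> has_real_derivative D) (at t)"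
  shows "D / (\<sigma> t)\<^sup>2 - 2 * (deriv \<sigma> t)\<^sup>2 / (\<sigma> t) ^ 3 = ((\<sigma> t)\<^sup>2 - (\<sigma> t) ^ 3) * \<alpha>"
    (is "?K = ?s * \<alpha>")
proof -
  obtain v where "Q 0 v \<noteq> 0"
    using center_in_support by blast
  then obtain \<epsilon> where "\<epsilon> > 0" and
    \<epsilon>: "\<And>r p. \<lbrakk>0 < r; r < \<epsilon>; \<bar>p - v \<bullet> e1\<bar> < \<epsilon>\<rbrakk> \<Longrightarrow> (r, p) \<in> radial_base profile"
    using radial_base_near_center[OF radial_form_Q open_Q] by blast
  have "((\<lambda>\<rho>. U' \<rho> / \<rho>) \<longlongrightarrow> \<alpha>) (at_right 0)"
    using U'' by (auto simp: has_field_derivative_iff U'_0 intro: tendsto_within_subset)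
  then have "((\<lambda>\<rho>. ?s * (U' \<rho> / \<rho>)) \<longlongrightarrow> ?s * \<alpha>) (at_right 0)"
    by (intro tendsto_intros)
  moreover have "eventually (\<lambda>\<rho>. ?s * (U' \<rho> / \<rho>) = ?K) (at_right 0)"
    using eventually_at_right_less[of "0 :: real"] eventually_at_right_real[OF \<open>\<epsilon> > 0\<close>]
  proof eventually_elim
    case (elim \<rho>)
    then have "(\<rho>, v \<bullet> e1) \<in> radial_base profile"
      using \<epsilon> \<open>\<epsilon> > 0\<close> by simp
    from force_balance[OF this D] show ?case
      using elim by (simp add: field_simps)
  qed
  ultimately have "((\<lambda>\<rho>. ?K) \<longlongrightarrow> ?s * \<alpha>) (at_right (0 :: real))"
    by (rule Lim_transform_eventually)
  then show ?thesis
    by (simp add: tendsto_const_iff)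
qed

lemma harmonic_on_base:
  assumes "\<sigma> t \<noteq> 1" "(\<rho>, \<pi>) \<in> radial_base profile"
  shows "U' \<rho> = \<alpha> * \<rho>"
proof -
  obtain D where D: "(deriv \<sigma> has_real_derivative D) (at t)"
    using sigma_twice_differentiable by blast
  have "((\<sigma> t)\<^sup>2 - (\<sigma> t) ^ 3) * U' \<rho> = ((\<sigma> t)\<^sup>2 - (\<sigma> t) ^ 3) * (\<alpha> * \<rho>)"
    using force_balance[OF assms(2) D] unfolding sigma_ode[OF D] by (simp only: ac_simps)
  moreover have "(\<sigma> t)\<^sup>2 - (\<sigma> t) ^ 3 = (\<sigma> t)\<^sup>2 * (1 - \<sigma> t)"
    by (simp add: power2_eq_square power3_eq_cube algebra_simps)
  ultimately show ?thesis
    using assms(1) sigma_nonzero[of t] by simp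
qed

text \<open>
  The radii occurring in the support of \<open>Q\<close> form a connected set that contains \<open>0\<close>.
\<close>

lemma base_radii_downward_closed:
  assumes "(r, p) \<in> radial_base profile" "0 < s" "s < r"
  shows "\<exists>q. (s, q) \<in> radial_base profile"
proof -
  let ?N = "(\<lambda>z. norm (fst z)) ` {(x, v). Q x v \<noteq> 0}"
  have "connected ?N"
    using connected_support by (intro connected_continuous_image) (auto intro!: continuous_intros)
  moreover have "0 \<in> ?N"
    using center_in_support by force
  moreover have "r \<in> ?N"
    using assms(1) unfolding radial_base_eq_image[OF radial_form_Q] by force
  ultimately have "s \<in> ?N"
    using connectedD_interval[of ?N 0 r s] assms by simp
  then obtain x v where "s = norm x" "Q x v \<noteq> 0"
    by auto
  then show ?thesis
    using radial_base_memI[OF radial_form_Q, of x v] \<open>0 < s\<close> by auto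
qed

text \<open>
  The closure adds at most the outermost radius and \<open>r = 0\<close>. At the former \<open>U'\<close> is not known to be continuous;
  but \<open>U - \<alpha> r\<^sup>2 / 2\<close> is constant below it and differentiable at it, so its derivative there is
  the vanishing left derivative.
\<close>

lemma harmonic_on_support:
  assumes "\<sigma> t \<noteq> 1" "(r, p) \<in> radial_support profile"
  shows "U' r = \<alpha> * r"
proof -
  have "radial_base profile \<subseteq> {0..} \<times> UNIV"
    by (auto simp: radial_base_def)
  then have "closure (radial_base profile) \<subseteq> {0..} \<times> UNIV"
    by (intro closure_minimal closed_Times) auto
  then have "0 \<le> r"
    using assms(2) by (auto simp: radial_support_eq)
  then consider "r = 0" | "0 < r"
    by linarith
  then show ?thesis
  proof cases
    case 1
    then show ?thesis
      by (simp add: U'_0)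
  next
    case 2
    have interior: "U' s = \<alpha> * s" if "0 < s" "s < r" for s
    proof -
      have "\<exists>y\<in>radial_base profile. dist y (r, p) < r - s"
        using assms(2) \<open>s < r\<close> by (simp add: radial_support_eq closure_approachable)
      then obtain y where y: "y \<in> radial_base profile" "dist y (r, p) < r - s"
        by blast
      obtain r' p' where "y = (r', p')"
        by (cases y)
      with y have "(r', p') \<in> radial_base profile" "dist (r', p') (r, p) < r - s"
        by simp_all
      moreover have "dist r' r \<le> dist (r', p') (r, p)"
        using dist_fst_le[of "(r', p')" "(r, p)"] by simp
      ultimately have "s < r'"
        by (simp add: dist_real_def)
      then obtain q where "(s, q) \<in> radial_base profile"
        using base_radii_downward_closed \<open>(r', p') \<in> radial_base profile\<close> \<open>0 < s\<close> by blast
      then show ?thesis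
        using harmonic_on_base assms(1) by blast
    qed
    let ?g = "\<lambda>s. U s - \<alpha> * s\<^sup>2 / 2"
    have dg: "(?g has_real_derivative U' s - \<alpha> * s) (at s)" if "0 < s" for s
      by (auto intro!: derivative_eq_intros U'_at that)
    have "?g s = ?g r" if "0 < s" "s < r" for s
    proof (rule sym, rule DERIV_isconst_end[OF \<open>s < r\<close>])
      show "continuous_on {s..r} ?g"
        using \<open>0 < s\<close> by (intro continuous_at_imp_continuous_on ballI DERIV_isCont[OF dg]) auto
      show "(?g has_real_derivative 0) (at x)" if "s < x" "x < r" for x
        using dg[of x] interior[of x] that \<open>0 < s\<close> by simp
    qed
    then have "eventually (\<lambda>s. (?g s - ?g r) / (s - r) = 0) (at_left r)"
      using eventually_at_left_real[OF \<open>0 < r\<close>] by (auto elim: eventually_mono)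
    then have "((\<lambda>s. (?g s - ?g r) / (s - r)) \<longlongrightarrow> 0) (at_left r)"
      by (rule tendsto_eventually)
    moreover have "((\<lambda>s. (?g s - ?g r) / (s - r)) \<longlongrightarrow> U' r - \<alpha> * r) (at_left r)"
      using dg[OF \<open>0 < r\<close>] unfolding has_field_derivative_iff by (rule tendsto_within_subset) simp
    ultimately have "U' r - \<alpha> * r = 0"
      using tendsto_unique[of "at_left r"] by force
    then show ?thesis
      by simp
  qed
qed

lemma linear_on_support:
  assumes "(r, p) \<in> radial_support (f t)"
  shows "R t r p = \<sigma> t * r" "P t r p = p / \<sigma> t + deriv \<sigma> t * r / (\<sigma> t)\<^sup>2"
proof -
  let ?S = "radial_base (f t)"
  have "?S \<subseteq> {0..} \<times> UNIV"
    by (auto simp: radial_base_def)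
  then have "closure ?S \<subseteq> {0..} \<times> UNIV"
    by (intro closure_minimal closed_Times) auto
  then have cont: "continuous_on (closure ?S) (\<lambda>z. (R t (fst z) (snd z), P t (fst z) (snd z)))"
    by (intro continuous_Z_comp continuous_intros) auto
  have "continuous_on (closure ?S) (\<lambda>z. (R t (fst z) (snd z), P t (fst z) (snd z))
      - (\<sigma> t * fst z, snd z / \<sigma> t + deriv \<sigma> t * fst z / (\<sigma> t)\<^sup>2))"
    by (rule continuous_on_diff[OF cont], intro continuous_intros) (simp_all add: sigma_nonzero)
  from continuous_constant_on_closure[OF this, of 0 "(r, p)"]
  have "(R t r p, P t r p) - (\<sigma> t * r, p / \<sigma> t + deriv \<sigma> t * r / (\<sigma> t)\<^sup>2) = 0"
    using assms R_eq_sigma P_eq_sigma by (auto simp: radial_support_eq zero_prod_def)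
  then show "R t r p = \<sigma> t * r" "P t r p = p / \<sigma> t + deriv \<sigma> t * r / (\<sigma> t)\<^sup>2"
    by (simp_all add: zero_prod_def)
qed

text \<open>
  The expansion factor is \<open>\<phi> = 1 / \<sigma>\<close>.
\<close>

lemma homologous_motion: "\<exists>\<phi> \<phi>' :: real \<Rightarrow> real.
    (\<forall>t. 0 < \<phi> t) \<and>
    (\<forall>t. (\<phi> has_real_derivative \<phi>' t) (at t)) \<and>
    (\<forall>t. (\<phi>' has_real_derivative \<alpha> * (- 1 / (\<phi> t)\<^sup>2 + 1 / (\<phi> t) ^ 3)) (at t)) \<and>
    (\<forall>t. \<forall>(r, p) \<in> radial_support (f t).
       R t r p = r / \<phi> t \<and> P t r p = \<phi> t * p - \<phi>' t * r) \<and>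
    ((\<exists>t. \<phi> t \<noteq> 1) \<longrightarrow>
       (\<forall>(r, p) \<in> radial_support (\<lambda>r p \<beta>. Qt (radial_energy U r p \<beta>) \<beta>). U' r = \<alpha> * r))"
proof -
  define \<phi> where "\<phi> t = 1 / \<sigma> t" for t
  define \<phi>' where "\<phi>' t = - (deriv \<sigma> t / (\<sigma> t)\<^sup>2)" for t
  have s: "\<sigma> t \<noteq> 0" for t
    by (rule sigma_nonzero)
  have "0 < \<phi> t" for t
    using sigma_pos by (simp add: \<phi>_def)
  moreover have "(\<phi> has_real_derivative \<phi>' t) (at t)" for t
    unfolding \<phi>_def \<phi>'_def using s
    by (auto intro!: derivative_eq_intros sigma_has_derivative simp: power2_eq_square)
  moreover have "(\<phi>' has_real_derivative \<alpha> * (- 1 / (\<phi> t)\<^sup>2 + 1 / (\<phi> t) ^ 3)) (at t)" for t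
  proof -
    obtain D where D: "(deriv \<sigma> has_real_derivative D) (at t)"
      using sigma_twice_differentiable by blast
    have "(\<phi>' has_real_derivative - (D / (\<sigma> t)\<^sup>2 - 2 * (deriv \<sigma> t)\<^sup>2 / (\<sigma> t) ^ 3)) (at t)"
      unfolding \<phi>'_def by (intro DERIV_minus sigma_quotient_derivative D)
    also have "- (D / (\<sigma> t)\<^sup>2 - 2 * (deriv \<sigma> t)\<^sup>2 / (\<sigma> t) ^ 3)
        = \<alpha> * (- 1 / (\<phi> t)\<^sup>2 + 1 / (\<phi> t) ^ 3)"
      unfolding sigma_ode[OF D] by (simp add: \<phi>_def power_divide algebra_simps)
    finally show ?thesis .
  qed
  moreover have "R t r p = r / \<phi> t \<and> P t r p = \<phi> t * p - \<phi>' t * r"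
    if "(r, p) \<in> radial_support (f t)" for t r p
    using linear_on_support[OF that] by (simp add: \<phi>_def \<phi>'_def mult.commute)
  moreover have "U' r = \<alpha> * r" if "\<phi> t \<noteq> 1" "(r, p) \<in> radial_support profile" for t r p
    using that harmonic_on_support[of t r p] s[of t] by (auto simp: \<phi>_def)
  ultimately show ?thesis
    by (intro exI[of _ \<phi>] exI[of _ \<phi>']) auto
qed

end

section \<open>The theorem\<close>

theorem theorem1p1:
  fixes Qt :: "real \<Rightarrow> real \<Rightarrow> real"
    and Q :: phase_fun
    and U U' :: "real \<Rightarrow> real"
    and \<alpha> :: real
    and R P :: "real \<Rightarrow> real \<Rightarrow> real \<Rightarrow> real"
    and F :: "real \<Rightarrow> phase_fun"
    and f :: "real \<Rightarrow> real \<Rightarrow> real \<Rightarrow> real \<Rightarrow> real"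
    and H :: "real \<Rightarrow> real \<Rightarrow> real \<Rightarrow> real"
  assumes steady: "vlasov_poisson (\<lambda>t. Q)"
    and Q: "\<forall>x v. Q x v = Qt (energy U x v) (ang_mom_sq x v)"
    and U: "\<forall>x. potential Q x = U (norm x)"
    and U': "\<forall>r\<ge>0. (U has_real_derivative U' r) (at r within {0..})"
    and U'': "(U' has_real_derivative \<alpha>) (at 0 within {0..})"
    and connected_support: "connected {(x, v). Q x v \<noteq> 0}"
    and center_in_support: "\<exists>v. Q 0 v \<noteq> 0"
    and solution: "vlasov_poisson F"
    and F: "\<forall>t. radial_form (F t) (f t)"
    and f: "\<forall>t r p \<beta>. 0 < r \<longrightarrow> 0 \<le> \<beta> \<longrightarrow>
              f t r p \<beta> = Qt (radial_energy U (R t r p) (P t r p) \<beta>) \<beta>"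
    and smooth_R: "C2_on {(t, r, p). 0 \<le> r} (\<lambda>(t, r, p). R t r p)"
    and smooth_P: "C2_on {(t, r, p). 0 \<le> r} (\<lambda>(t, r, p). P t r p)"
    and smooth_H: "\<forall>t. C2_on {(r, p). 0 < r} (\<lambda>(r, p). H t r p)"
    and hamilton_R: "\<forall>t r p. 0 < r \<longrightarrow>
          ((\<lambda>s. R s r p) has_real_derivative deriv (\<lambda>q. H t (R t r p) q) (P t r p)) (at t)"
    and hamilton_P: "\<forall>t r p. 0 < r \<longrightarrow>
          ((\<lambda>s. P s r p) has_real_derivative - deriv (\<lambda>q. H t q (P t r p)) (R t r p)) (at t)"
    and a1: "\<forall>x v. Q x v \<noteq> 0 \<longrightarrow>
          (\<exists>d. d \<noteq> 0 \<and> ((\<lambda>e. Qt e (ang_mom_sq x v)) has_real_derivative d) (at (energy U x v)))"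
    and a2: "U' 0 = 0"
    and b1: "\<forall>t r p. 0 < r \<longrightarrow> 0 < deriv (\<lambda>s. R t s p) r"
    and b2: "\<exists>\<sigma>. \<forall>t p. ((\<lambda>\<delta>. R t \<delta> p / \<delta>) \<longlongrightarrow> \<sigma> t) (at_right (0 :: real))"
    and c: "\<forall>r p. 0 < r \<longrightarrow>
          deriv (\<lambda>s. R 0 s p) r * deriv (\<lambda>q. P 0 r q) p
          - deriv (\<lambda>q. R 0 r q) p * deriv (\<lambda>s. P 0 s p) r = 1"
  shows "\<exists>\<phi> \<phi>' :: real \<Rightarrow> real.
    (\<forall>t. 0 < \<phi> t) \<and>
    (\<forall>t. (\<phi> has_real_derivative \<phi>' t) (at t)) \<and>
    (\<forall>t. (\<phi>' has_real_derivative \<alpha> * (- 1 / (\<phi> t)\<^sup>2 + 1 / (\<phi> t) ^ 3)) (at t)) \<and>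
    (\<forall>t. \<forall>(r, p) \<in> radial_support (f t).
       R t r p = r / \<phi> t \<and> P t r p = \<phi> t * p - \<phi>' t * r) \<and>
    ((\<exists>t. \<phi> t \<noteq> 1) \<longrightarrow>
       (\<forall>(r, p) \<in> radial_support (\<lambda>r p \<beta>. Qt (radial_energy U r p \<beta>) \<beta>). U' r = \<alpha> * r))"
proof -
  obtain Rt Rr Rp Rtt Rtr Rtp where
    dR: "\<And>t r p. 0 \<le> r \<Longrightarrow> ((\<lambda>(t, r, p). R t r p) has_derivative
       (\<lambda>(a, b, c). a * Rt t r p + b * Rr t r p + c * Rp t r p)) (at (t, r, p) within {(t, r, p). 0 \<le> r})"
    and contR: "continuous_on {(t, r, p). 0 \<le> r} (\<lambda>(t, r, p). Rr t r p)"
      "continuous_on {(t, r, p). 0 \<le> r} (\<lambda>(t, r, p). Rp t r p)"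
    and Rtt: "\<And>t r p. 0 < r \<Longrightarrow> ((\<lambda>s. Rt s r p) has_real_derivative Rtt t r p) (at t)"
    and mixedR: "\<And>t r p. 0 < r \<Longrightarrow> ((\<lambda>s. Rr s r p) has_real_derivative Rtr t r p) (at t)"
      "\<And>t r p. 0 < r \<Longrightarrow> ((\<lambda>s. Rt t s p) has_real_derivative Rtr t r p) (at r)"
      "\<And>t r p. 0 < r \<Longrightarrow> ((\<lambda>s. Rp s r p) has_real_derivative Rtp t r p) (at t)"
      "\<And>t r p. 0 < r \<Longrightarrow> ((\<lambda>s. Rt t r s) has_real_derivative Rtp t r p) (at p)"
    by (rule half_space_partials[OF smooth_R]) blast
  obtain Pt Pr Pp Ptt Ptr Ptp where
    dP: "\<And>t r p. 0 \<le> r \<Longrightarrow> ((\<lambda>(t, r, p). P t r p) has_derivative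
       (\<lambda>(a, b, c). a * Pt t r p + b * Pr t r p + c * Pp t r p)) (at (t, r, p) within {(t, r, p). 0 \<le> r})"
    and contP: "continuous_on {(t, r, p). 0 \<le> r} (\<lambda>(t, r, p). Pr t r p)"
      "continuous_on {(t, r, p). 0 \<le> r} (\<lambda>(t, r, p). Pp t r p)"
    and "\<And>t r p. 0 < r \<Longrightarrow> ((\<lambda>s. Pt s r p) has_real_derivative Ptt t r p) (at t)"
    and mixedP: "\<And>t r p. 0 < r \<Longrightarrow> ((\<lambda>s. Pr s r p) has_real_derivative Ptr t r p) (at t)"
      "\<And>t r p. 0 < r \<Longrightarrow> ((\<lambda>s. Pt t s p) has_real_derivative Ptr t r p) (at r)"
      "\<And>t r p. 0 < r \<Longrightarrow> ((\<lambda>s. Pp s r p) has_real_derivative Ptp t r p) (at t)"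
      "\<And>t r p. 0 < r \<Longrightarrow> ((\<lambda>s. Pt t r s) has_real_derivative Ptp t r p) (at p)"
    by (rule half_space_partials[OF smooth_P]) blast
  obtain \<sigma> where \<sigma>: "\<And>t p. ((\<lambda>\<delta>. R t \<delta> p / \<delta>) \<longlongrightarrow> \<sigma> t) (at_right 0)"
    using b2 by blast
  have dR': "((\<lambda>(t, r, p). R t r p) has_derivative
       (\<lambda>(a, b, c). a * Rt t r p + b * Rr t r p + c * Rp t r p)) (at (t, r, p))"
    and dP': "((\<lambda>(t, r, p). P t r p) has_derivative
       (\<lambda>(a, b, c). a * Pt t r p + b * Pr t r p + c * Pp t r p)) (at (t, r, p))" if "0 < r" for t r p
    using that by (intro has_derivative_at_interior_half_space dR dP; simp)+
  \<comment> \<open>\<open>R\<close> vanishes at \<open>r = 0\<close>, since \<open>R / r\<close> has a limit there, and increases with \<open>r\<close>.\<close>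
  have R_pos: "0 < R t r p" if "0 < r" for t r p
  proof -
    have "continuous_on {(t, r, p). 0 \<le> r} (\<lambda>(t, r, p). R t r p)"
      unfolding continuous_on_eq_continuous_within using has_derivative_continuous[OF dR] by auto
    then have cont: "continuous_on {0..} (\<lambda>r. (\<lambda>(t, r, p). R t r p) (t, r, p))"
      by (rule continuous_on_compose2) (auto intro!: continuous_intros)
    then have "R t 0 p = 0"
      using zero_of_finite_slope[OF _ \<sigma>] by simp
    moreover have "R t 0 p < R t r p"
    proof (rule DERIV_pos_imp_increasing_open[OF \<open>0 < r\<close>])
      fix x :: real assume "0 < x"
      have "((\<lambda>s. R t s p) has_real_derivative Rr t x p) (at x)"
        using partials_of_derivative(2)[OF dR'[OF \<open>0 < x\<close>]] .
      moreover from this have "0 < Rr t x p"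
        using b1 \<open>0 < x\<close> by (metis DERIV_imp_deriv)
      ultimately show "\<exists>y. ((\<lambda>s. R t s p) has_real_derivative y) (at x) \<and> 0 < y"
        by blast
    next
      show "continuous_on {0..r} (\<lambda>r. R t r p)"
        using continuous_on_subset[OF cont, of "{0..r}"] by auto
    qed
    ultimately show ?thesis
      by simp
  qed
  have jacobian: "Rr t r p * Pp t r p - Rp t r p * Pr t r p = 1" if "0 < r" for t r p
  proof -
    have "Rr t r p * Pp t r p - Rp t r p * Pr t r p = Rr 0 r p * Pp 0 r p - Rp 0 r p * Pr 0 r p"
      using smooth_H hamilton_R hamilton_P
      by (intro hamiltonian_flow_jacobian_constant[OF dR' dP' mixedR mixedP _ _ _ R_pos \<open>0 < r\<close>]) auto
    also have "\<dots> = 1"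
      using c[rule_format, OF \<open>0 < r\<close>, of p]
      by (simp add: DERIV_imp_deriv[OF partials_of_derivative(2)[OF dR'[OF \<open>0 < r\<close>]]]
          DERIV_imp_deriv[OF partials_of_derivative(3)[OF dR'[OF \<open>0 < r\<close>]]]
          DERIV_imp_deriv[OF partials_of_derivative(2)[OF dP'[OF \<open>0 < r\<close>]]]
          DERIV_imp_deriv[OF partials_of_derivative(3)[OF dP'[OF \<open>0 < r\<close>]]])
    finally show ?thesis .
  qed
  interpret energy_substitution Qt Q U U' \<alpha> R P F f Rt Rr Rp Rtt Pt Pr Pp \<sigma>
  proof
    show "vlasov_poisson (\<lambda>t. Q)" "vlasov_poisson F" "(U' has_real_derivative \<alpha>) (at 0 within {0..})"
      "U' 0 = 0" "connected {(x, v). Q x v \<noteq> 0}" "\<exists>v. Q 0 v \<noteq> 0"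
      by fact+
  qed (rule Q[rule_format] U[rule_format] U'[rule_format] F[rule_format] f[rule_format] a1[rule_format]
      dR dP contR contP Rtt jacobian R_pos \<sigma>; assumption)+
  show ?thesis
    by (rule homologous_motion)
qed

end
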